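(* Let $d\ge2$ be an integer, $0<\beta<1$ and $\lambda>0$. Define $h(x)=\frac{\beta+(1-\beta)x}{1-(1-\beta)x}$ and $f(x)=\frac{1}{1+\lambda h(x)^d}$ for $x\in[0,1]$, and let $x^\star$ be the unique fixed point of $f$ in $[0,1]$. If $f'(x^\star)>-1$, then strong spatial mixing holds for the anti-ferromagnetic Ising model with edge activity $\beta$ and vertex activity $\lambda$ on the infinite $d$-ary tree; in particular, this model has a unique Gibbs measure on the infinite $d$-ary tree.
   Context: The infinite $d$-ary tree is the infinite rooted tree with root $\rho$ in which every vertex has exactly $d$ children. The function $f$ is strictly decreasing on $[0,1]$, so it has a unique fixed point. Ising model with edge activity $\beta$ and vertex activity $\lambda$: on a finite graph $(V,E)$ a configuration $\sigma:V\to\{+,-\}$ has weight $\lambda^{m(\sigma)}\beta^{n(\sigma)}$, where $m(\sigma)$ is the number of vertices with spin $-$ and $n(\sigma)$ is the number of edges whose endpoints have equal spins. On an infinite graph, a Gibbs measure is a probability measure on configurations such that for every finite vertex set $\Lambda$, conditionally on the configuration outside $\Lambda$, the probability of a configuration on $\Lambda$ is proportional to $\lambda^{m}\beta^{n}$, where $m$ is the number of vertices of $\Lambda$ with spin $-$ and $n$ is the number of edges with at least one endpoint in $\Lambda$ whose two endpoints have equal spins. If the spins on a vertex set $S$ are fixed to a configuration $\sigma$ on $S$, Gibbs measures for the conditioned system are defined in the same way, using only finite sets $\Lambda$ disjoint from $S$ and requiring the spins on $S$ to equal $\sigma$. For a nonempty vertex set $S$ and a configuration $\sigma$ on $S$,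 $p_\rho(\sigma,S)$ denotes the probability that $\rho$ has spin $+$ when the spins on $S$ are fixed according to $\sigma$ (if the conditioned system has several Gibbs measures, the inequality below is required for every choice of them). $\delta(\rho,T)$ is the graph distance from $\rho$ to $T$. Strong spatial mixing: there are constants $C,\kappa>0$ such that for every nonempty vertex set $S$, every nonempty $T\subseteq S$, and any two configurations $\sigma_1,\sigma_2$ on $S$ which differ only on vertices of $T$, $|p_\rho(\sigma_1,S)-p_\rho(\sigma_2,S)|\le C e^{-\kappa\,\delta(\rho,T)}$. *)

theory Defs
  imports "HOL-Probability.Probability"
begin

section \<open>The Ising model on a locally finite graph\<close>

text \<open>
  A graph is given by a vertex set \<open>V\<close> and a set \<open>E\<close> of two-element subsets of \<open>V\<close>.
  Vertices need not exhaust the type, so configurations on \<open>V\<close> are extensional functions,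
  that is, the points of \<open>space (config_space V)\<close>.
\<close>

datatype spin = Plus | Minus

definition config_space :: "'v set \<Rightarrow> ('v \<Rightarrow> spin) measure" where
  "config_space V = PiM V (\<lambda>_. count_space UNIV)"

definition minus_count :: "'v set \<Rightarrow> ('v \<Rightarrow> spin) \<Rightarrow> nat" where
  "minus_count \<Lambda> \<sigma> = card {v \<in> \<Lambda>. \<sigma> v = Minus}"

definition equal_edge_count :: "'v set set \<Rightarrow> 'v set \<Rightarrow> ('v \<Rightarrow> spin) \<Rightarrow> nat" where
  "equal_edge_count E \<Lambda> \<sigma> = card {e \<in> E. e \<inter> \<Lambda> \<noteq> {} \<and> (\<forall>u\<in>e. \<forall>v\<in>e. \<sigma> u = \<sigma> v)}"

definition ising_weight ::
    "'v set set \<Rightarrow> real \<Rightarrow> real \<Rightarrow> 'v set \<Rightarrow> ('v \<Rightarrow> spin) \<Rightarrow> real" where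
  "ising_weight E \<beta> lam \<Lambda> \<sigma> = lam ^ minus_count \<Lambda> \<sigma> * \<beta> ^ equal_edge_count E \<Lambda> \<sigma>"

text \<open>The probability of \<open>\<xi>\<close> on the finite set \<open>\<Lambda>\<close> given that \<open>\<eta>\<close> is seen outside \<open>\<Lambda>\<close>.\<close>

definition ising_spec ::
    "'v set set \<Rightarrow> real \<Rightarrow> real \<Rightarrow> 'v set \<Rightarrow> ('v \<Rightarrow> spin) \<Rightarrow> ('v \<Rightarrow> spin) \<Rightarrow> real" where
  "ising_spec E \<beta> lam \<Lambda> \<xi> \<eta> =
     ising_weight E \<beta> lam \<Lambda> (override_on \<eta> \<xi> \<Lambda>) /
     (\<Sum>\<zeta> \<in> \<Lambda> \<rightarrow>\<^sub>E UNIV. ising_weight E \<beta> lam \<Lambda> (override_on \<eta> \<zeta> \<Lambda>))"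

text \<open>The \<open>\<sigma>\<close>-algebra generated by the spins outside \<open>\<Lambda>\<close>.\<close>

definition outside_algebra :: "'v set \<Rightarrow> 'v set \<Rightarrow> ('v \<Rightarrow> spin) measure" where
  "outside_algebra V \<Lambda> =
     vimage_algebra (space (config_space V)) (\<lambda>\<eta>. restrict \<eta> (V - \<Lambda>)) (config_space (V - \<Lambda>))"

text \<open>Only the values of \<open>\<sigma>\<close> on \<open>S\<close> matter.\<close>

definition conditioned_gibbs_measure ::
    "'v set \<Rightarrow> 'v set set \<Rightarrow> real \<Rightarrow> real \<Rightarrow> 'v set \<Rightarrow> ('v \<Rightarrow> spin) \<Rightarrow> ('v \<Rightarrow> spin) measure \<Rightarrow> bool" where
  "conditioned_gibbs_measure V E \<beta> lam S \<sigma> \<mu> \<longleftrightarrow>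
     prob_space \<mu> \<and> sets \<mu> = sets (config_space V) \<and>
     (AE \<eta> in \<mu>. \<forall>v\<in>S. \<eta> v = \<sigma> v) \<and>
     (\<forall>\<Lambda> \<xi>. finite \<Lambda> \<and> \<Lambda> \<subseteq> V - S \<and> \<xi> \<in> \<Lambda> \<rightarrow>\<^sub>E UNIV \<longrightarrow>
        (AE \<eta> in \<mu>. real_cond_exp \<mu> (outside_algebra V \<Lambda>)
             (indicator {\<tau> \<in> space \<mu>. \<forall>v\<in>\<Lambda>. \<tau> v = \<xi> v}) \<eta> = ising_spec E \<beta> lam \<Lambda> \<xi> \<eta>))"

definition gibbs_measure ::
    "'v set \<Rightarrow> 'v set set \<Rightarrow> real \<Rightarrow> real \<Rightarrow> ('v \<Rightarrow> spin) measure \<Rightarrow> bool" where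
  "gibbs_measure V E \<beta> lam \<mu> \<longleftrightarrow> conditioned_gibbs_measure V E \<beta> lam {} (\<lambda>_. undefined) \<mu>"

section \<open>Strong spatial mixing\<close>

definition graph_dist :: "'v set set \<Rightarrow> 'v \<Rightarrow> 'v \<Rightarrow> nat" where
  "graph_dist E u v = (LEAST n. (u, v) \<in> {(a, b). {a, b} \<in> E} ^^ n)"

definition graph_dist_set :: "'v set set \<Rightarrow> 'v \<Rightarrow> 'v set \<Rightarrow> nat" where
  "graph_dist_set E u T = (INF t\<in>T. graph_dist E u t)"

definition plus_prob :: "'v \<Rightarrow> ('v \<Rightarrow> spin) measure \<Rightarrow> real" where
  "plus_prob v \<mu> = measure \<mu> {\<eta> \<in> space \<mu>. \<eta> v = Plus}"

text \<open>
  A conditioned system may have several Gibbs measures; the bound is required for all choices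
  \<open>\<mu>\<^sub>1\<close>, \<open>\<mu>\<^sub>2\<close> of Gibbs measures for the two conditionings. The set \<open>S\<close> may be infinite.
\<close>

definition strong_spatial_mixing ::
    "'v set \<Rightarrow> 'v set set \<Rightarrow> 'v \<Rightarrow> real \<Rightarrow> real \<Rightarrow> bool" where
  "strong_spatial_mixing V E \<rho> \<beta> lam \<longleftrightarrow>
     (\<exists>C>0. \<exists>\<kappa>>0. \<forall>S T \<sigma>\<^sub>1 \<sigma>\<^sub>2 \<mu>\<^sub>1 \<mu>\<^sub>2.
        S \<subseteq> V \<and> S \<noteq> {} \<and> T \<subseteq> S \<and> T \<noteq> {} \<and> (\<forall>v \<in> S - T. \<sigma>\<^sub>1 v = \<sigma>\<^sub>2 v) \<and>
        conditioned_gibbs_measure V E \<beta> lam S \<sigma>\<^sub>1 \<mu>\<^sub>1 \<and>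
        conditioned_gibbs_measure V E \<beta> lam S \<sigma>\<^sub>2 \<mu>\<^sub>2 \<longrightarrow>
        \<bar>plus_prob \<rho> \<mu>\<^sub>1 - plus_prob \<rho> \<mu>\<^sub>2\<bar> \<le> C * exp (- \<kappa> * real (graph_dist_set E \<rho> T)))"

section \<open>The infinite \<open>d\<close>-ary tree and its recursion\<close>

text \<open>
  Vertices are the words over \<open>{0, \<dots>, d - 1}\<close>; the root is the empty word and the children of
  \<open>w\<close> are the \<open>d\<close> words \<open>i # w\<close>.
\<close>

definition tree_verts :: "nat \<Rightarrow> nat list set" where
  "tree_verts d = lists {..<d}"

definition tree_edges :: "nat \<Rightarrow> nat list set set" where
  "tree_edges d = {{w, i # w} | w i. w \<in> tree_verts d \<and> i < d}"

definition tree_root :: "nat list" where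
  "tree_root = []"

definition ising_h :: "real \<Rightarrow> real \<Rightarrow> real" where
  "ising_h \<beta> x = (\<beta> + (1 - \<beta>) * x) / (1 - (1 - \<beta>) * x)"

definition ising_f :: "nat \<Rightarrow> real \<Rightarrow> real \<Rightarrow> real \<Rightarrow> real" where
  "ising_f d \<beta> lam x = 1 / (1 + lam * ising_h \<beta> x ^ d)"

end

theory Submission
  imports Defs
begin

text \<open>
  Put \<open>u = ln (h x)\<close> and \<open>G u = (1 + \<beta>\<^sup>2 - 2 \<beta> cosh u) / (1 - \<beta>\<^sup>2)\<close>. In the metric \<open>du / sqrt (G u)\<close> one step of
  the tree recursion, with output \<open>u'\<close>, contracts by the factor \<open>sqrt (G u') (\<Sum>i<d. sqrt (G u\<^sub>i))\<close>, which by concavity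
  of \<open>G\<close> is largest when all \<open>u\<^sub>i\<close> are equal to their mean. A calculus argument shows that \<open>d\<^sup>2 G u G u'\<close> stays
  below 1 on the whole range as soon as \<open>d G u < 1\<close> at the fixed point, that is, \<open>f' x > -1\<close>. Pinned children have
  \<open>G u = 0\<close> and only shift the field, so the contraction is uniform in the conditioning set.
  Disagreements at distance \<open>n\<close> from the root thus have an effect of order \<open>\<alpha> ^ n\<close>, and without pinning all messages
  tend to the fixed point, which determines every finite marginal of a Gibbs measure. The tree-indexed
  Markov chain built from the fixed point is a Gibbs measure.
\<close>

section \<open>Contraction of the tree recursion\<close>

text \<open>In the metric \<open>du\<close> itself one step contracts by \<open>d * gain u'\<close>.
  Its worst value \<open>d * gain 0\<close> does not involve \<open>lam\<close> and may exceed 1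
  although the fixed point is stable. Dividing by the square root of \<open>gain\<close> shares the
  gain of a vertex evenly between the step that produces its message and the step that consumes it.
  With equal children the factor is then \<open>d * sqrt (gain u * gain u')\<close>, which at the
  fixed point equals \<open>d * gain us\<close>, the absolute value of \<open>f' x\<close>: nothing
  is lost there. The obstacle is that the hypothesis concerns a single point, while pinning can move
  the mean of the children's messages to any place between \<open>- umax\<close> and
  \<open>umax\<close>, so a global maximum has to be controlled. This is tractable because the
  derivative of \<open>gain\<close> is a multiple of \<open>sinh\<close>: at a critical point with
  image \<open>v\<close>, \<open>d * gain u\<close> is the ratio of \<open>sinh u\<close> and
  \<open>sinh v\<close>, and the fixed point needs to be compared only with these two
  points.\<close>

locale antiferro_ising =
  fixes d :: nat and \<beta> lam :: real
  assumes d_pos: "d \<ge> 1" and beta_pos: "0 < \<beta>" and beta_less: "\<beta> < 1" and lam_pos: "0 < lam"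
begin

section \<open>The logarithmic coordinate and its gain\<close>

definition umax :: real where "umax = - ln \<beta>"

text \<open>In the coordinate \<open>u = ln (ising_h \<beta> x)\<close>, \<open>x\<close> the probability of a plus, the tree recursion reads
  \<open>u = relay (ln lam + (\<Sum>i<d. u\<^sub>i))\<close> and \<open>relay\<close> satisfies \<open>relay' = - gain \<circ> relay\<close>.\<close>

definition gain :: "real \<Rightarrow> real" where
  "gain u = (1 + \<beta>\<^sup>2 - 2 * \<beta> * cosh u) / (1 - \<beta>\<^sup>2)"

definition relay :: "real \<Rightarrow> real" where
  "relay w = ln ((1 + \<beta> * exp w) / (\<beta> + exp w))"

lemma umax_pos: "umax > 0"
  using beta_pos beta_less by (simp add: umax_def)

lemma beta_sq_less: "\<beta>\<^sup>2 < 1"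
  using beta_pos beta_less by (simp add: power_less_one_iff)

lemma exp_umax: "exp umax = 1 / \<beta>"
  using beta_pos by (simp add: umax_def exp_minus field_simps)

lemma gain_minus [simp]: "gain (- u) = gain u"
  by (simp add: gain_def)

lemma gain_abs [simp]: "gain \<bar>u\<bar> = gain u"
  by (simp add: abs_if)

lemma gain_umax [simp]: "gain umax = 0"
  using beta_pos beta_sq_less by (simp add: gain_def cosh_def exp_umax exp_minus field_simps power2_eq_square)

lemma gain_antimono:
  assumes "\<bar>u\<bar> \<le> \<bar>v\<bar>" shows "gain v \<le> gain u"
proof -
  have "cosh \<bar>u\<bar> \<le> cosh \<bar>v\<bar>"
    using assms by (subst cosh_real_nonneg_le_iff) auto
  hence "cosh u \<le> cosh v" by (simp add: abs_if split: if_splits)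
  thus ?thesis unfolding gain_def
    using beta_pos beta_sq_less by (intro divide_right_mono) auto
qed

lemma gain_nonneg: "\<bar>u\<bar> \<le> umax \<Longrightarrow> 0 \<le> gain u"
  using gain_antimono[of u umax] umax_pos by simp

lemma gain_zero: "gain 0 = (1 - \<beta>) / (1 + \<beta>)"
proof -
  have "1 - \<beta>\<^sup>2 \<noteq> 0" "1 + \<beta> \<noteq> 0" using beta_sq_less beta_pos by auto
  thus ?thesis by (simp add: gain_def divide_simps) (simp add: power2_eq_square algebra_simps)
qed

lemma gain_zero_pos: "gain 0 > 0"
  using beta_pos beta_less by (simp add: gain_zero)

text \<open>Convexity of \<open>cosh\<close> makes \<open>gain\<close> concave, and this is its
  chord from 0 to \<open>umax\<close>. It shows that \<open>gain\<close> vanishes no faster than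
  linearly at \<open>umax\<close>, so that the metric is integrable up to the pinned values.\<close>

lemma gain_ge_chord:
  assumes "0 \<le> s" "s \<le> 1"
  shows "gain (s * umax) \<ge> gain 0 * (1 - s)"
proof -
  have e: "exp (s * x) \<le> (1 - s) + s * exp x" for x :: real
    using convex_onD[OF exp_convex, of s 0 x] assms by simp
  have "cosh (s * umax) \<le> (1 - s) + s * cosh umax"
    using e[of umax] e[of "- umax"] by (simp add: cosh_def algebra_simps)
  hence "2 * \<beta> * cosh (s * umax) \<le> 2 * \<beta> * ((1 - s) + s * cosh umax)"
    using beta_pos by simp
  hence "gain (s * umax) \<ge> (1 + \<beta>\<^sup>2 - 2 * \<beta> * ((1 - s) + s * cosh umax)) / (1 - \<beta>\<^sup>2)"
    unfolding gain_def using beta_sq_less by (intro divide_right_mono) auto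
  also have "1 + \<beta>\<^sup>2 - 2 * \<beta> * ((1 - s) + s * cosh umax) =
      (1 - s) * (1 + \<beta>\<^sup>2 - 2 * \<beta> * cosh 0) + s * (1 + \<beta>\<^sup>2 - 2 * \<beta> * cosh umax)"
    by (simp add: algebra_simps)
  also have "\<dots> / (1 - \<beta>\<^sup>2) = (1 - s) * gain 0 + s * gain umax"
    by (simp only: gain_def add_divide_distrib times_divide_eq_right)
  finally show ?thesis by (simp add: mult.commute)
qed

lemma gain_exp: "gain u = (1 + \<beta>\<^sup>2 - \<beta> * (exp u + inverse (exp u))) / (1 - \<beta>\<^sup>2)"
  by (simp add: gain_def cosh_def exp_minus)

lemma exp_relay: "exp (relay w) = (1 + \<beta> * exp w) / (\<beta> + exp w)"
  unfolding relay_def using beta_pos by (intro exp_ln divide_pos_pos add_pos_pos mult_pos_pos) auto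

lemma gain_relay: "gain (relay w) = (1 - \<beta>\<^sup>2) * exp w / ((1 + \<beta> * exp w) * (\<beta> + exp w))"
proof -
  define R where "R = exp w"
  have pos: "1 + \<beta> * R > 0" "\<beta> + R > 0" "1 - \<beta>\<^sup>2 > 0"
    using beta_pos beta_sq_less by (auto simp: R_def intro!: add_pos_pos)
  have "gain (relay w) * (1 - \<beta>\<^sup>2) = 1 + \<beta>\<^sup>2 - \<beta> * ((1 + \<beta> * R) / (\<beta> + R) + (\<beta> + R) / (1 + \<beta> * R))"
    unfolding gain_exp exp_relay R_def[symmetric] using pos by simp
  also have "\<dots> = (1 - \<beta>\<^sup>2) * ((1 - \<beta>\<^sup>2) * R / ((1 + \<beta> * R) * (\<beta> + R)))"
    using pos(1,2) by (simp add: divide_simps) algebra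
  finally have "(1 - \<beta>\<^sup>2) * gain (relay w) = (1 - \<beta>\<^sup>2) * ((1 - \<beta>\<^sup>2) * R / ((1 + \<beta> * R) * (\<beta> + R)))"
    by (simp only: mult.commute)
  thus ?thesis using pos(3) unfolding R_def by (subst (asm) mult_left_cancel) auto
qed

lemma DERIV_relay: "(relay has_real_derivative - gain (relay w)) (at w)"
proof -
  have pos: "1 + \<beta> * exp w > 0" "\<beta> + exp w > 0"
    using beta_pos by (auto intro!: add_pos_pos)
  have "relay = (\<lambda>w. ln (1 + \<beta> * exp w) - ln (\<beta> + exp w))"
  proof
    fix w :: real
    have "1 + \<beta> * exp w > 0" "\<beta> + exp w > 0"
      using beta_pos by (auto intro!: add_pos_pos)
    thus "relay w = ln (1 + \<beta> * exp w) - ln (\<beta> + exp w)"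
      by (simp add: relay_def ln_div)
  qed
  hence "(relay has_real_derivative \<beta> * exp w / (1 + \<beta> * exp w) - exp w / (\<beta> + exp w)) (at w)"
    using pos by (auto intro!: derivative_eq_intros simp: field_simps)
  moreover have "\<beta> * exp w / (1 + \<beta> * exp w) - exp w / (\<beta> + exp w) = - gain (relay w)"
    unfolding gain_relay using pos by (simp add: divide_simps) algebra
  ultimately show ?thesis by simp
qed

lemma abs_relay_le: "\<bar>relay w\<bar> \<le> umax"
proof -
  have pos: "1 + \<beta> * exp w > 0" "\<beta> + exp w > 0"
    using beta_pos by (auto intro!: add_pos_pos)
  have "\<beta> * \<beta> \<le> 1" using beta_sq_less by (simp add: power2_eq_square)
  hence "exp w * (\<beta> * \<beta>) \<le> exp w * 1" by (intro mult_left_mono) auto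
  hence "exp (relay w) \<le> exp umax"
    unfolding exp_relay exp_umax using pos beta_pos by (simp add: field_simps)
  moreover have "exp (- umax) \<le> exp (relay w)"
    unfolding exp_relay exp_minus exp_umax using pos beta_pos \<open>\<beta> * \<beta> \<le> 1\<close> by (simp add: field_simps)
  ultimately show ?thesis by auto
qed

lemma relay_antimono: "v \<le> w \<Longrightarrow> relay w \<le> relay v"
  using DERIV_nonpos_imp_nonincreasing[of v w relay] DERIV_relay gain_nonneg[OF abs_relay_le]
  by (metis neg_le_0_iff_le)

section \<open>Two consecutive steps with equal children\<close>

lemma DERIV_gain: "(gain has_real_derivative - (2 * \<beta> / (1 - \<beta>\<^sup>2)) * sinh u) (at u)"
proof -
  have "((\<lambda>u. 1 + \<beta>\<^sup>2 - 2 * \<beta> * cosh u) has_real_derivative - (2 * \<beta> * sinh u)) (at u)"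
    by (auto intro!: derivative_eq_intros)
  from DERIV_cdivide[OF this, of "1 - \<beta>\<^sup>2"] show ?thesis
    by (simp add: gain_def [abs_def])
qed

text \<open>The hypothesis \<open>cr\<close> holds at an interior maximum of the left-hand side. As \<open>u\<close> and its image lie on
  different sides of the fixed point \<open>us\<close>, comparing \<open>cosh\<close> and \<open>sinh\<close> at the three points gives the bound.\<close>

lemma two_step_gain_less_one:
  fixes us u :: real
  assumes fp: "relay (ln lam + d * us) = us" and us: "real d * gain us < 1" and u: "\<bar>u\<bar> \<le> umax"
    and cr: "sinh u = d * gain u * sinh (relay (ln lam + d * u))"
  shows "(real d)\<^sup>2 * gain u * gain (relay (ln lam + d * u)) < 1"
proof -
  define v where "v = relay (ln lam + d * u)"
  have gu: "0 \<le> gain u" and gv: "0 \<le> gain v"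
    using gain_nonneg u abs_relay_le by (auto simp: v_def)
  have mono: "u \<le> us \<Longrightarrow> us \<le> v" "us \<le> u \<Longrightarrow> v \<le> us"
    using relay_antimono[of "ln lam + d * u" "ln lam + d * us"]
      relay_antimono[of "ln lam + d * us" "ln lam + d * u"] fp
    by (auto simp: v_def mult_left_mono)
  have cr': "sinh u = (d * gain u) * sinh v" using cr v_def by simp
  have "0 \<le> d * gain u" using gu by simp
  have cra: "sinh \<bar>u\<bar> = (d * gain u) * sinh \<bar>v\<bar>"
  proof -
    have "\<bar>sinh u\<bar> = (d * gain u) * \<bar>sinh v\<bar>" unfolding cr' abs_mult using gu by simp
    thus ?thesis by (simp add: sinh_real_abs)
  qed
  have "(d * gain u) * (d * gain v) < 1"
  \<comment> \<open>The main case divides by \<open>sinh v\<close>. If \<open>v = 0\<close>, then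
    \<open>u\<close> and \<open>us\<close> are 0 as well.\<close>
  proof (cases "v = 0")
    case True
    hence "u = 0" using cr' by simp
    hence "us = 0" using mono True by fastforce
    have "(d * gain 0) * (d * gain 0) < 1 * 1"
      using us \<open>us = 0\<close> gain_zero_pos by (intro mult_strict_mono) auto
    thus ?thesis using \<open>u = 0\<close> True by simp
  next
    case False
    \<comment> \<open>By \<open>cr'\<close> the points \<open>u\<close> and \<open>v\<close> do not
      have opposite signs, so the order of \<open>u\<close>, \<open>us\<close>, \<open>v\<close>
      given by \<open>mono\<close> carries over to absolute values, on which \<open>gain\<close> and
      \<open>sinh\<close> are monotone.\<close>
    have ord: "(\<bar>u\<bar> \<le> \<bar>us\<bar> \<and> \<bar>us\<bar> \<le> \<bar>v\<bar>) \<or> (\<bar>v\<bar> \<le> \<bar>us\<bar> \<and> \<bar>us\<bar> \<le> \<bar>u\<bar>)"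
    proof (cases "v > 0")
      case True
      hence "0 \<le> sinh u" unfolding cr' using gu by simp
      thus ?thesis using True mono by (cases "u \<le> us") auto
    next
      case False
      hence "sinh u \<le> 0" unfolding cr' using gu by (simp add: mult_nonneg_nonpos)
      thus ?thesis using False mono by (cases "u \<le> us") auto
    qed
    have sv: "sinh \<bar>v\<bar> > 0" using False by simp
    have q: "d * gain u = sinh \<bar>u\<bar> / sinh \<bar>v\<bar>"
      unfolding cra using sv by (intro nonzero_mult_div_cancel_right[symmetric]) linarith
    show ?thesis
    proof (cases "\<bar>u\<bar> \<le> \<bar>us\<bar> \<and> \<bar>us\<bar> \<le> \<bar>v\<bar>")
      case True
      hence "sinh \<bar>u\<bar> \<le> sinh \<bar>v\<bar>" by (intro sinh_real_le_iff[THEN iffD2]) linarith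
      hence "d * gain u \<le> 1" unfolding q using sv by (intro divide_le_eq_1_pos[THEN iffD2])
      moreover have "d * gain v \<le> d * gain us" using True gain_antimono[of us v] by (simp add: mult_left_mono)
      ultimately have "(d * gain u) * (d * gain v) \<le> 1 * (d * gain us)"
        using gu gv by (intro mult_mono[of "d * gain u" 1 "d * gain v" "d * gain us"]) simp_all
      thus ?thesis using us by simp
    next
      \<comment> \<open>This order is contradictory: it would give
        \<open>1 \<le> d * gain u \<le> d * gain us < 1\<close>.\<close>
      case F: False
      hence o: "\<bar>v\<bar> \<le> \<bar>us\<bar>" "\<bar>us\<bar> \<le> \<bar>u\<bar>" using ord by auto
      hence "sinh \<bar>v\<bar> \<le> sinh \<bar>u\<bar>" by (intro sinh_real_le_iff[THEN iffD2]) linarith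
      hence "1 \<le> d * gain u" unfolding q using sv by (intro le_divide_eq_1_pos[THEN iffD2])
      moreover have "d * gain u \<le> d * gain us"
        using o gain_antimono[of us u] by (simp add: mult_left_mono)
      ultimately show ?thesis using us by simp
    qed
  qed
  thus ?thesis by (simp add: v_def power2_eq_square mult_ac)
qed

text \<open>Compactness turns the strict bound at critical points into a uniform one. A positive
  maximum is interior because \<open>gain\<close> vanishes at both ends of the interval.\<close>

lemma two_step_gain_bounded:
  fixes us :: real
  assumes fp: "relay (ln lam + d * us) = us" and us: "real d * gain us < 1"
  shows "\<exists>\<alpha>>0. \<alpha> < 1 \<and> (\<forall>u::real. \<bar>u\<bar> \<le> umax \<longrightarrow>
           (real d)\<^sup>2 * gain u * gain (relay (ln lam + d * u)) \<le> \<alpha>\<^sup>2)"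
proof -
  define P where "P u = (real d)\<^sup>2 * gain u * gain (relay (ln lam + d * u))" for u :: real
  define c where "c = 2 * \<beta> / (1 - \<beta>\<^sup>2)"
  have cpos: "c > 0" using beta_pos beta_sq_less by (simp add: c_def)
  \<comment> \<open>In this factored form the last bracket is the critical point equation
    \<open>cr\<close> of \<open>two_step_gain_less_one\<close>.\<close>
  have dP: "(P has_real_derivative (real d)\<^sup>2 * (c * gain (relay (ln lam + d * u)) *
      (d * gain u * sinh (relay (ln lam + d * u)) - sinh u))) (at u)" for u :: real
  proof -
    have 1: "((\<lambda>u. relay (ln lam + d * u)) has_real_derivative - gain (relay (ln lam + d * u)) * d) (at u)"
      by (rule DERIV_chain2[OF DERIV_relay]) (auto intro!: derivative_eq_intros)
    have 2: "((\<lambda>u. gain (relay (ln lam + d * u))) has_real_derivative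
       (- c * sinh (relay (ln lam + d * u))) * (- gain (relay (ln lam + d * u)) * d)) (at u)"
      unfolding c_def by (rule DERIV_chain2[OF DERIV_gain 1])
    have 3: "(gain has_real_derivative - c * sinh u) (at u)"
      unfolding c_def by (rule DERIV_gain)
    show ?thesis unfolding P_def [abs_def]
      by (rule DERIV_cong[OF DERIV_mult[OF DERIV_cmult[OF 3] 2]]) (simp add: algebra_simps)
  qed
  have "continuous_on {-umax..umax} P"
    by (intro DERIV_continuous_on) (rule DERIV_subset[OF dP], simp)
  then obtain u0 where u0: "u0 \<in> {-umax..umax}" "\<And>u. u \<in> {-umax..umax} \<Longrightarrow> P u \<le> P u0"
    using continuous_attains_sup[of "{-umax..umax}" P] umax_pos by auto
  have "P u0 < 1"
  proof (cases "P u0 \<le> 0")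
    case False
    have "u0 \<noteq> umax" "u0 \<noteq> - umax" using False by (auto simp: P_def)
    hence i: "-umax < u0" "u0 < umax" using u0 by auto
    have "(real d)\<^sup>2 * (c * gain (relay (ln lam + d * u0)) *
      (d * gain u0 * sinh (relay (ln lam + d * u0)) - sinh u0)) = 0"
    proof (rule DERIV_local_max[OF dP])
      show "0 < min (umax - u0) (u0 + umax)" using i by auto
      show "\<forall>y. \<bar>u0 - y\<bar> < min (umax - u0) (u0 + umax) \<longrightarrow> P y \<le> P u0"
        by (intro allI impI u0(2)) auto
    qed
    moreover have "gain (relay (ln lam + d * u0)) \<noteq> 0" using False by (auto simp: P_def)
    ultimately have "sinh u0 = d * gain u0 * sinh (relay (ln lam + d * u0))"
      using cpos d_pos by simp
    thus ?thesis unfolding P_def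
      using two_step_gain_less_one[OF fp us] u0 by auto
  qed auto
  \<comment> \<open>The floor 1/4 keeps \<open>\<alpha>\<close> positive whatever the maximum is,
    since \<open>- ln \<alpha>\<close> becomes the decay rate.\<close>
  define \<alpha> where "\<alpha> = sqrt (max (1/4) (P u0))"
  have "\<alpha> > 0" "\<alpha> < 1" using \<open>P u0 < 1\<close> by (auto simp: \<alpha>_def less_max_iff_disj)
  moreover have "\<alpha>\<^sup>2 = max (1/4) (P u0)" by (simp add: \<alpha>_def le_max_iff_disj)
  ultimately show ?thesis using u0(2) unfolding P_def[symmetric]
    by (intro exI[of _ \<alpha>]) (force simp: abs_le_iff le_max_iff_disj)
qed

section \<open>Contraction in the weighted metric\<close>

lemma sum_sqrt_gain_le:
  assumes "\<And>i. i < d \<Longrightarrow> \<bar>u i\<bar> \<le> umax"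
  shows "(\<Sum>i<d. sqrt (gain (u i))) \<le> d * sqrt (gain ((\<Sum>i<d. u i) / d))"
proof -
  define m where "m = (\<Sum>i<d. u i) / d"
  have dm: "(\<Sum>i<d. u i) = d * m" using d_pos by (simp add: m_def)
  \<comment> \<open>Jensen by hand: summing the tangent line of the exponential at the mean
    \<open>m\<close> cancels the linear terms. The cases \<open>c = 1\<close> and
    \<open>c = -1\<close> together give \<open>cosh\<close>; Cauchy-Schwarz against the constant 1
    then passes to square roots.\<close>
  have ex: "(\<Sum>i<d. exp (c * u i)) \<ge> d * exp (c * m)" for c :: real
  proof -
    have "exp (c * u i) \<ge> exp (c * m) * (1 + (c * u i - c * m))" for i
      using mult_left_mono[OF exp_ge_add_one_self[of "c * u i - c * m"], of "exp (c * m)"]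
      by (simp add: exp_diff)
    hence "(\<Sum>i<d. exp (c * u i)) \<ge> (\<Sum>i<d. exp (c * m) * (1 + (c * u i - c * m)))"
      by (intro sum_mono)
    also have "(\<Sum>i<d. exp (c * m) * (1 + (c * u i - c * m))) = d * exp (c * m)"
      using dm by (simp add: sum_distrib_left[symmetric] sum.distrib sum_subtractf)
    finally show ?thesis .
  qed
  have "(\<Sum>i<d. cosh (u i)) \<ge> d * cosh m"
    using ex[of 1] ex[of "-1"] by (simp add: cosh_def sum.distrib sum_divide_distrib[symmetric] field_simps)
  hence "2 * \<beta> * (\<Sum>i<d. cosh (u i)) \<ge> 2 * \<beta> * (d * cosh m)" using beta_pos by simp
  hence "((\<Sum>i<d. 1 + \<beta>\<^sup>2 - 2 * \<beta> * cosh (u i))) / (1 - \<beta>\<^sup>2) \<le> d * (1 + \<beta>\<^sup>2 - 2 * \<beta> * cosh m) / (1 - \<beta>\<^sup>2)"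
    using beta_sq_less
    by (intro divide_right_mono) (auto simp: sum_subtractf sum_distrib_left[symmetric] algebra_simps)
  hence J: "(\<Sum>i<d. gain (u i)) \<le> d * gain m"
    by (simp add: gain_def sum_divide_distrib)
  have "(\<Sum>i<d. 1 * sqrt (gain (u i)))\<^sup>2 \<le> (\<Sum>i<d. 1\<^sup>2) * (\<Sum>i<d. (sqrt (gain (u i)))\<^sup>2)"
    by (rule Cauchy_Schwarz_ineq_sum)
  also have "\<dots> = d * (\<Sum>i<d. gain (u i))"
    using assms gain_nonneg by simp
  also have "\<dots> \<le> d * (d * gain m)" using J by (intro mult_left_mono) auto
  finally have "(\<Sum>i<d. sqrt (gain (u i))) \<le> sqrt (d * (d * gain m))"
    by (intro real_le_rsqrt) simp
  also have "sqrt (d * (d * gain m)) = d * sqrt (gain m)"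
    unfolding mult.assoc[symmetric] by (simp add: real_sqrt_mult)
  finally show ?thesis by (simp add: m_def)
qed

text \<open>\<open>close D u v\<close> says that the distance of \<open>u\<close> and \<open>v\<close> in the metric \<open>du / sqrt (gain u)\<close> is at most \<open>D\<close>.
  Phrasing this through curves avoids the elliptic integral that would be its potential function;
  the pinned values \<open>u = umax\<close> and \<open>u = - umax\<close>, where the metric is singular, need no special treatment.\<close>

definition close :: "real \<Rightarrow> real \<Rightarrow> real \<Rightarrow> bool" where
  "close D u v \<longleftrightarrow> (\<exists>c c'. c 0 = u \<and> c 1 = v \<and>
     (\<forall>t\<in>{0..1::real}. \<bar>c t\<bar> \<le> umax \<and> (c has_real_derivative c' t) (at t) \<and> \<bar>c' t\<bar> \<le> D * sqrt (gain (c t))))"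

lemma close_refl: "D \<ge> 0 \<Longrightarrow> \<bar>u\<bar> \<le> umax \<Longrightarrow> close D u u"
  unfolding close_def
  by (intro exI[of _ "\<lambda>_. u"] exI[of _ "\<lambda>_. 0"]) (auto simp: gain_nonneg)

text \<open>\<open>gain\<close> is largest at 0, so the mean value theorem converts metric distance
  into ordinary distance.\<close>

lemma close_imp_abs_diff_le:
  assumes "close D u v" "D \<ge> 0"
  shows "\<bar>u - v\<bar> \<le> D * sqrt (gain 0)"
proof -
  obtain c c' where c: "c 0 = u" "c 1 = v"
    "\<And>t. t \<in> {0..1} \<Longrightarrow> \<bar>c t\<bar> \<le> umax \<and> (c has_real_derivative c' t) (at t) \<and> \<bar>c' t\<bar> \<le> D * sqrt (gain (c t))"
    using assms(1) unfolding close_def by blast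
  obtain z where z: "0 < z" "z < 1" "c 1 - c 0 = (1 - 0) * c' z"
    using MVT2[of 0 1 c c'] c(3) by auto
  have "\<bar>c' z\<bar> \<le> D * sqrt (gain (c z))" using c(3) z by auto
  also have "\<dots> \<le> D * sqrt (gain 0)"
    using gain_antimono[of 0 "c z"] assms by (intro mult_left_mono) auto
  finally show ?thesis using z c by auto
qed

text \<open>The metric has finite diameter although it is singular at both ends. The sine curve
  slows down there: its speed is proportional to \<open>cos \<theta>\<close>, while
  \<open>gain_ge_chord\<close> and \<open>(1 - s\<^sup>2) / 2 \<le> 1 - s\<close> with
  \<open>s = \<bar>sin \<theta>\<bar>\<close> bound \<open>gain (c t)\<close> below by
  \<open>gain 0 * (cos \<theta>)\<^sup>2 / 2\<close>. The factor \<open>pi\<close> bounds the range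
  of angles.\<close>

lemma close_base:
  assumes "\<bar>u\<bar> \<le> umax" "\<bar>v\<bar> \<le> umax"
  shows "close (umax * pi * sqrt (2 / gain 0)) u v"
proof -
  define a b where "a = arcsin (u / umax)" and "b = arcsin (v / umax)"
  define c where "c t = umax * sin (a + t * (b - a))" for t
  define c' where "c' t = umax * (cos (a + t * (b - a)) * (b - a))" for t
  have r: "\<bar>u / umax\<bar> \<le> 1" "\<bar>v / umax\<bar> \<le> 1" using assms umax_pos by auto
  have ab: "\<bar>b - a\<bar> \<le> pi"
    using arcsin_bounded[of "u / umax"] arcsin_bounded[of "v / umax"] r
    unfolding a_def b_def by linarith
  have "sin a = u / umax" "sin b = v / umax"
    unfolding a_def b_def using r by (intro sin_arcsin; linarith)+
  hence "c 0 = u" "c 1 = v" using umax_pos by (auto simp: c_def)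
  moreover have "\<bar>c t\<bar> \<le> umax" for t
    using umax_pos by (simp add: c_def abs_mult mult_left_le)
  moreover have "(c has_real_derivative c' t) (at t)" for t
    unfolding c_def [abs_def] c'_def by (auto intro!: derivative_eq_intros)
  moreover have "\<bar>c' t\<bar> \<le> umax * pi * sqrt (2 / gain 0) * sqrt (gain (c t))" for t
  proof -
    define \<theta> where "\<theta> = a + t * (b - a)"
    define s where "s = \<bar>sin \<theta>\<bar>"
    have s: "0 \<le> s" "s \<le> 1" by (auto simp: s_def)
    have "0 \<le> (1 - s) * (1 - s)" by simp
    hence "(1 - s\<^sup>2) / 2 \<le> 1 - s" by (simp add: power2_eq_square field_simps)
    hence "gain 0 * ((1 - s\<^sup>2) / 2) \<le> gain 0 * (1 - s)"
      using gain_zero_pos by (intro mult_left_mono) auto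
    also have "\<dots> \<le> gain (s * umax)" by (rule gain_ge_chord[OF s])
    also have "s * umax = \<bar>c t\<bar>"
      using umax_pos by (simp add: s_def c_def \<theta>_def abs_mult)
    finally have cs: "(cos \<theta>)\<^sup>2 \<le> 2 / gain 0 * gain (c t)"
      using gain_zero_pos by (simp add: s_def sin_squared_eq field_simps)
    have "0 \<le> 2 / gain 0 * gain (c t)" by (rule order_trans[OF zero_le_power2 cs])
    moreover from cs have "\<bar>cos \<theta>\<bar> \<le> sqrt (2 / gain 0 * gain (c t))"
      by (metis real_sqrt_abs real_sqrt_le_iff)
    ultimately have "umax * (\<bar>cos \<theta>\<bar> * \<bar>b - a\<bar>) \<le> umax * (sqrt (2 / gain 0 * gain (c t)) * pi)"
      using ab umax_pos by (intro mult_left_mono mult_mono) auto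
    thus ?thesis using umax_pos
      unfolding c'_def \<theta>_def[symmetric] abs_mult real_sqrt_mult by (simp add: mult_ac)
  qed
  ultimately show ?thesis unfolding close_def by (intro exI[of _ c] exI[of _ c']) auto
qed

text \<open>All children move along their curves at the same time and the output traces
  \<open>C\<close>. One factor \<open>sqrt (gain (C t))\<close> of its speed is the metric at the
  output; the other one combines with the children into the two-step product.\<close>

lemma close_relay:
  fixes u v :: "nat \<Rightarrow> real" and \<alpha> :: real
  assumes cl: "\<And>i. i < d \<Longrightarrow> close D (u i) (v i)" and D: "D \<ge> 0" and "\<alpha> \<ge> 0"
    and \<alpha>: "\<And>u::real. \<bar>u\<bar> \<le> umax \<Longrightarrow> (real d)\<^sup>2 * gain u * gain (relay (ln lam + d * u)) \<le> \<alpha>\<^sup>2"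
  shows "close (\<alpha> * D) (relay (ln lam + (\<Sum>i<d. u i))) (relay (ln lam + (\<Sum>i<d. v i)))"
proof -
  obtain c c' where c: "\<And>i. i < d \<Longrightarrow> c i 0 = u i \<and> c i 1 = v i"
    "\<And>i t. i < d \<Longrightarrow> t \<in> {0..1} \<Longrightarrow> \<bar>c i t\<bar> \<le> umax \<and> (c i has_real_derivative c' i t) (at t)
        \<and> \<bar>c' i t\<bar> \<le> D * sqrt (gain (c i t))"
    using cl unfolding close_def by metis
  define C where "C t = relay (ln lam + (\<Sum>i<d. c i t))" for t
  define C' where "C' t = - gain (C t) * (\<Sum>i<d. c' i t)" for t
  have "C 0 = relay (ln lam + (\<Sum>i<d. u i))" "C 1 = relay (ln lam + (\<Sum>i<d. v i))"
    using c(1) by (auto simp: C_def)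
  moreover have "\<bar>C t\<bar> \<le> umax" for t
    by (simp add: C_def abs_relay_le)
  moreover have "(C has_real_derivative C' t) (at t)" if "t \<in> {0..1}" for t
    unfolding C_def [abs_def] C'_def
    by (rule DERIV_chain2[OF DERIV_relay]) (use c(2) that in \<open>auto intro!: derivative_eq_intros DERIV_sum\<close>)
  moreover have "\<bar>C' t\<bar> \<le> \<alpha> * D * sqrt (gain (C t))" if t: "t \<in> {0..1}" for t
  proof -
    define m where "m = (\<Sum>i<d. c i t) / d"
    have dm: "d * m = (\<Sum>i<d. c i t)" using d_pos by (simp add: m_def)
    have "\<bar>\<Sum>i<d. c i t\<bar> \<le> (\<Sum>i<d. umax)"
      using c(2) t by (intro sum_abs[THEN order_trans] sum_mono) auto
    hence m: "\<bar>m\<bar> \<le> umax" using d_pos by (simp add: m_def field_simps)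
    have gC: "0 \<le> gain (C t)" by (simp add: C_def gain_nonneg abs_relay_le)
    have "\<bar>\<Sum>i<d. c' i t\<bar> \<le> (\<Sum>i<d. D * sqrt (gain (c i t)))"
      using c(2) t by (intro sum_abs[THEN order_trans] sum_mono) auto
    also have "\<dots> \<le> D * (d * sqrt (gain m))"
      unfolding sum_distrib_left[symmetric] m_def
      using c(2) t D by (intro mult_left_mono sum_sqrt_gain_le) auto
    finally have 1: "\<bar>\<Sum>i<d. c' i t\<bar> \<le> D * (d * sqrt (gain m))" .
    \<comment> \<open>The recursion sees only the sum of the children, so \<open>C t\<close> is also
      the image of \<open>d\<close> children all equal to \<open>m\<close>.\<close>
    have "(real d)\<^sup>2 * gain m * gain (C t) \<le> \<alpha>\<^sup>2"
      using \<alpha>[OF m] by (simp add: C_def dm)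
    hence "sqrt ((real d)\<^sup>2 * gain m * gain (C t)) \<le> \<alpha>"
      using \<open>\<alpha> \<ge> 0\<close> by (intro real_le_lsqrt) auto
    hence 2: "sqrt (gain (C t)) * (d * sqrt (gain m)) \<le> \<alpha>"
      by (simp add: real_sqrt_mult mult_ac)
    have "\<bar>C' t\<bar> = sqrt (gain (C t)) * (sqrt (gain (C t)) * \<bar>\<Sum>i<d. c' i t\<bar>)"
      using gC by (simp add: C'_def abs_mult)
    also have "\<dots> \<le> sqrt (gain (C t)) * (sqrt (gain (C t)) * (D * (d * sqrt (gain m))))"
      using 1 gC by (intro mult_left_mono) auto
    also have "\<dots> = D * sqrt (gain (C t)) * (sqrt (gain (C t)) * (d * sqrt (gain m)))"
      by (simp add: mult_ac)
    also have "\<dots> \<le> D * sqrt (gain (C t)) * \<alpha>"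
      using 2 D gC by (intro mult_left_mono) auto
    finally show ?thesis by (simp add: mult_ac)
  qed
  ultimately show ?thesis unfolding close_def by (intro exI[of _ C] exI[of _ C']) auto
qed

text \<open>The map \<open>u \<mapsto> relay (ln lam + d * u)\<close> is \<open>ising_f\<close>
  conjugated by \<open>x \<mapsto> ln (ising_h \<beta> x)\<close>, so both have the same derivative
  at corresponding fixed points. The proof confirms this by differentiating \<open>ising_f\<close>
  directly, with \<open>n\<close> and \<open>e\<close> the numerator and denominator of
  \<open>ising_h\<close>.\<close>

lemma
  assumes x: "x \<in> {0..1}" and fp: "ising_f d \<beta> lam x = x"
  shows relay_fixed_point: "relay (ln lam + d * ln (ising_h \<beta> x)) = ln (ising_h \<beta> x)"
    and deriv_ising_f_fixed_point: "deriv (ising_f d \<beta> lam) x = - (d * gain (ln (ising_h \<beta> x)))"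
proof -
  define n e where "n = \<beta> + (1 - \<beta>) * x" and "e = 1 - (1 - \<beta>) * x"
  define h where "h = ising_h \<beta> x"
  have n: "n > 0" using x beta_pos beta_less by (auto simp: n_def intro!: add_pos_nonneg)
  have "(1 - \<beta>) * x \<le> (1 - \<beta>) * 1" using x beta_less by (intro mult_left_mono) auto
  hence e: "e > 0" using beta_pos by (simp add: e_def)
  have h: "h = n / e" "h > 0" using n e by (auto simp: h_def ising_h_def n_def e_def)
  define R where "R = lam * h ^ d"
  have R: "R > 0" using lam_pos h by (simp add: R_def)
  have xR: "x = 1 / (1 + R)" using fp by (simp add: ising_f_def R_def h_def)
  have eR: "exp (ln lam + d * ln h) = R"
    using lam_pos h by (simp add: R_def exp_add exp_of_nat_mult)
  have "h = (1 + \<beta> * R) / (\<beta> + R)"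
  proof -
    have "n = (1 + \<beta> * R) / (1 + R)" "e = (\<beta> + R) / (1 + R)"
      using R by (auto simp: n_def e_def xR field_simps)
    thus ?thesis using R h by simp
  qed
  thus "relay (ln lam + d * ln (ising_h \<beta> x)) = ln (ising_h \<beta> x)"
    unfolding relay_def eR[unfolded h_def] by (simp add: h_def)
  define h' where "h' = (1 - \<beta>\<^sup>2) / e\<^sup>2"
  have dh: "(ising_h \<beta> has_real_derivative h') (at x)"
    unfolding ising_h_def [abs_def] h'_def using e
    by (auto intro!: derivative_eq_intros simp: e_def field_simps power2_eq_square)
  have "(ising_f d \<beta> lam has_real_derivative - (lam * (d * h ^ (d - 1) * h')) / (1 + R)\<^sup>2) (at x)"
    unfolding ising_f_def [abs_def] R_def using R
    by (auto intro!: derivative_eq_intros dh simp: h_def R_def power2_eq_square)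
  hence "deriv (ising_f d \<beta> lam) x = - (lam * (d * h ^ (d - 1) * h')) / (1 + R)\<^sup>2"
    by (rule DERIV_imp_deriv)
  also have "lam * (d * h ^ (d - 1) * h') = d * R * (h' / h)"
  proof -
    have "h ^ d = h * h ^ (d - 1)" using d_pos by (metis power_eq_if not_one_le_zero)
    thus ?thesis using h(2) by (simp add: R_def)
  qed
  also have "- (d * R * (h' / h)) / (1 + R)\<^sup>2 = - (d * ((x * (1 - x)) * (h' / h)))"
    using R by (simp add: xR field_simps power2_eq_square)
  also have "h' / h = (1 - \<beta>\<^sup>2) / (n * e)"
    using n e by (simp add: h'_def h power2_eq_square)
  also have "(x * (1 - x)) * ((1 - \<beta>\<^sup>2) / (n * e)) = gain (ln h)"
  proof -
    have "(1 - \<beta>\<^sup>2) * gain (ln h) = 1 + \<beta>\<^sup>2 - \<beta> * (n / e + e / n)"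
      unfolding gain_exp using h n e beta_sq_less by simp
    also have "\<dots> = (1 - \<beta>\<^sup>2) * ((x * (1 - x)) * ((1 - \<beta>\<^sup>2) / (n * e)))"
    proof -
      have "(1 + \<beta>\<^sup>2) * (n * e) - \<beta> * (n * n + e * e) = (1 - \<beta>\<^sup>2) * ((x * (1 - x)) * (1 - \<beta>\<^sup>2))"
        unfolding n_def e_def by algebra
      thus ?thesis using n e by (simp add: field_simps)
    qed
    finally show ?thesis
      using beta_sq_less by (subst (asm) mult_left_cancel) auto
  qed
  finally show "deriv (ising_f d \<beta> lam) x = - (d * gain (ln (ising_h \<beta> x)))"
    by (simp add: h_def)
qed

end

section \<open>Finite-volume sums on the tree\<close>

lemma UNIV_spin: "(UNIV :: spin set) = {Plus, Minus}"
  using spin.exhaust by auto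

instance spin :: finite
  by standard (simp add: UNIV_spin)

lemma sum_spin:
  fixes g :: "spin \<Rightarrow> 'a::comm_monoid_add"
  shows "(\<Sum>s\<in>UNIV. g s) = g Plus + g Minus"
  by (simp add: UNIV_spin)

definition depends_on :: "'v set \<Rightarrow> (('v \<Rightarrow> spin) \<Rightarrow> 'a) \<Rightarrow> bool" where
  "depends_on A \<phi> \<longleftrightarrow> (\<forall>\<tau> \<tau>'. (\<forall>v\<in>A. \<tau> v = \<tau>' v) \<longrightarrow> \<phi> \<tau> = \<phi> \<tau>')"

lemma depends_onD: "depends_on A \<phi> \<Longrightarrow> (\<And>v. v \<in> A \<Longrightarrow> \<tau> v = \<tau>' v) \<Longrightarrow> \<phi> \<tau> = \<phi> \<tau>'"
  by (simp add: depends_on_def)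

lemma depends_on_mono: "depends_on A \<phi> \<Longrightarrow> A \<subseteq> B \<Longrightarrow> depends_on B \<phi>"
  unfolding depends_on_def by blast

lemma sum_PiE_Un:
  assumes "A \<inter> B = {}"
  shows "(\<Sum>\<tau>\<in>(A \<union> B) \<rightarrow>\<^sub>E UNIV. F \<tau>) = (\<Sum>x\<in>A \<rightarrow>\<^sub>E UNIV. \<Sum>y\<in>B \<rightarrow>\<^sub>E UNIV. F (override_on y x A))"
  unfolding sum.cartesian_product
  by (rule sum.reindex_bij_witness[where i = "\<lambda>(x, y). override_on y x A"
        and j = "\<lambda>\<tau>. (restrict \<tau> A, restrict \<tau> B)"])
    (use assms in \<open>auto simp: fun_eq_iff override_on_def PiE_def extensional_def restrict_def
       intro!: arg_cong[of _ _ F]\<close>)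

text \<open>The part of the weight on \<open>\<Delta>\<close> that the spins on
  \<open>\<Lambda>\<close> do not enter. It is constant while \<open>\<Lambda>\<close> is resampled,
  hence cancels in \<open>ising_spec\<close>, and it allows the unpinned part of a ball to be
  replaced by the whole ball.\<close>

definition outer_weight :: "'v set set \<Rightarrow> real \<Rightarrow> real \<Rightarrow> 'v set \<Rightarrow> 'v set \<Rightarrow> ('v \<Rightarrow> spin) \<Rightarrow> real" where
  "outer_weight E \<beta> lam \<Lambda> \<Delta> \<tau> = lam ^ card {v \<in> \<Delta> - \<Lambda>. \<tau> v = Minus} *
     \<beta> ^ card {e \<in> E. e \<inter> \<Delta> \<noteq> {} \<and> e \<inter> \<Lambda> = {} \<and> (\<forall>u\<in>e. \<forall>v\<in>e. \<tau> u = \<tau> v)}"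

lemma outer_weight_pos: "0 < \<beta> \<Longrightarrow> 0 < lam \<Longrightarrow> 0 < outer_weight E \<beta> lam \<Lambda> \<Delta> \<tau>"
  by (simp add: outer_weight_def)

lemma outer_weight_override: "outer_weight E \<beta> lam \<Lambda> \<Delta> (override_on \<eta> \<xi> \<Lambda>) = outer_weight E \<beta> lam \<Lambda> \<Delta> \<eta>"
proof -
  have "{v \<in> \<Delta> - \<Lambda>. override_on \<eta> \<xi> \<Lambda> v = Minus} = {v \<in> \<Delta> - \<Lambda>. \<eta> v = Minus}"
    by (auto simp: override_on_def)
  moreover have "(\<forall>u\<in>e. \<forall>v\<in>e. override_on \<eta> \<xi> \<Lambda> u = override_on \<eta> \<xi> \<Lambda> v) = (\<forall>u\<in>e. \<forall>v\<in>e. \<eta> u = \<eta> v)"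
    if "e \<inter> \<Lambda> = {}" for e
    using that by (auto simp: override_on_def)
  hence "{e \<in> E. e \<inter> \<Delta> \<noteq> {} \<and> e \<inter> \<Lambda> = {} \<and> (\<forall>u\<in>e. \<forall>v\<in>e. override_on \<eta> \<xi> \<Lambda> u = override_on \<eta> \<xi> \<Lambda> v)}
    = {e \<in> E. e \<inter> \<Delta> \<noteq> {} \<and> e \<inter> \<Lambda> = {} \<and> (\<forall>u\<in>e. \<forall>v\<in>e. \<eta> u = \<eta> v)}" by blast
  ultimately show ?thesis unfolding outer_weight_def by simp
qed

lemma ising_weight_superset:
  assumes "finite \<Delta>" "\<Lambda> \<subseteq> \<Delta>" "finite {e \<in> E. e \<inter> \<Delta> \<noteq> {}}"
  shows "ising_weight E \<beta> lam \<Delta> \<tau> = ising_weight E \<beta> lam \<Lambda> \<tau> * outer_weight E \<beta> lam \<Lambda> \<Delta> \<tau>"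
proof -
  have "minus_count \<Delta> \<tau> = minus_count \<Lambda> \<tau> + card {v \<in> \<Delta> - \<Lambda>. \<tau> v = Minus}"
    unfolding minus_count_def using assms
    by (subst card_Un_disjoint[symmetric]) (auto intro!: arg_cong[of _ _ card] dest: finite_subset)
  moreover have "equal_edge_count E \<Delta> \<tau> = equal_edge_count E \<Lambda> \<tau> +
      card {e \<in> E. e \<inter> \<Delta> \<noteq> {} \<and> e \<inter> \<Lambda> = {} \<and> (\<forall>u\<in>e. \<forall>v\<in>e. \<tau> u = \<tau> v)}"
    unfolding equal_edge_count_def using assms(2)
    by (subst card_Un_disjoint[symmetric])
      (auto intro!: arg_cong[of _ _ card] finite_subset[OF _ assms(3)])
  ultimately show ?thesis
    by (simp add: ising_weight_def outer_weight_def power_add)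
qed

lemma ising_weight_pos: "0 < \<beta> \<Longrightarrow> 0 < lam \<Longrightarrow> 0 < ising_weight E \<beta> lam \<Lambda> \<tau>"
  by (simp add: ising_weight_def)

section \<open>Balls, levels and product weights on the tree\<close>

definition below :: "nat \<Rightarrow> nat \<Rightarrow> nat list set" where
  "below d n = {w \<in> tree_verts d. length w < n}"

definition level :: "nat \<Rightarrow> nat \<Rightarrow> nat list set" where
  "level d n = {w \<in> tree_verts d. length w = n}"

lemma below_0 [simp]: "below d 0 = {}" by (simp add: below_def)
lemma level_0 [simp]: "level d 0 = {[]}" by (auto simp: level_def tree_verts_def)

lemma below_Suc: "below d (Suc n) = below d n \<union> level d n"
  by (auto simp: below_def level_def)

lemma below_mono: "m \<le> n \<Longrightarrow> below d m \<subseteq> below d n"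
  by (auto simp: below_def)

lemma below_subset: "below d n \<subseteq> tree_verts d"
  by (auto simp: below_def)

lemma below_Int_level: "n \<le> m \<Longrightarrow> below d n \<inter> level d m = {}"
  by (auto simp: below_def level_def)

lemma finite_level [simp]: "finite (level d n)"
  using finite_lists_length_eq[of "{..<d}" n]
  by (simp add: level_def tree_verts_def lists_eq_set)

lemma finite_below [simp]: "finite (below d n)"
  by (induction n) (auto simp: below_Suc)

lemma Cons_in_level: "i < d \<Longrightarrow> w \<in> level d n \<Longrightarrow> i # w \<in> level d (Suc n)"
  by (auto simp: level_def tree_verts_def)

lemma Cons_in_below: "i < d \<Longrightarrow> w \<in> below d n \<Longrightarrow> i # w \<in> below d (Suc n)"
  by (auto simp: below_def tree_verts_def)

lemma finite_subset_below:
  assumes "finite A" "A \<subseteq> tree_verts d"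
  shows "\<exists>n. A \<subseteq> below d n"
proof -
  have "A \<subseteq> below d (Suc (Max (length ` A)))"
    using assms by (auto simp: below_def less_Suc_eq_le)
  thus ?thesis ..
qed

lemma prod_level_Suc: "(\<Prod>v\<in>level d (Suc n). g v) = (\<Prod>w\<in>level d n. \<Prod>i<d. g (i # w))"
proof -
  have "level d (Suc n) = (\<lambda>(w, i). i # w) ` (level d n \<times> {..<d})"
    by (auto simp: level_def tree_verts_def image_iff length_Suc_conv)
  moreover have "inj_on (\<lambda>(w, i). i # w) (level d n \<times> {..<d})"
    by (auto simp: inj_on_def)
  ultimately show ?thesis
    by (simp add: prod.reindex prod.cartesian_product split_def)
qed

lemma prod_below_Suc: "(\<Prod>v\<in>below d (Suc n). g v) = (\<Prod>v\<in>below d n. g v) * (\<Prod>v\<in>level d n. g v)"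
  unfolding below_Suc by (intro prod.union_disjoint) (auto simp: below_Int_level)

lemma tree_edge_inj: "{w, i # w} = {w', j # w'} \<Longrightarrow> w = w' \<and> i = j"
  by (auto simp: doubleton_eq_iff)

text \<open>The parent is the shorter endpoint, so an edge meets the ball exactly when its parent
  end does.\<close>

lemma tree_edges_touching_below:
  "{e \<in> tree_edges d. e \<inter> below d n \<noteq> {}} = (\<lambda>(w, i). {w, i # w}) ` (below d n \<times> {..<d})"
proof -
  have *: "{w, i # w} \<inter> below d n \<noteq> {} \<longleftrightarrow> w \<in> below d n" if "w \<in> tree_verts d" "i < d" for w i
    using that by (auto simp: below_def)
  show ?thesis
  proof (intro equalityI subsetI)
    fix e assume "e \<in> {e \<in> tree_edges d. e \<inter> below d n \<noteq> {}}"
    then obtain w i where "e = {w, i # w}" "w \<in> tree_verts d" "i < d" "e \<inter> below d n \<noteq> {}"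
      by (auto simp: tree_edges_def)
    thus "e \<in> (\<lambda>(w, i). {w, i # w}) ` (below d n \<times> {..<d})" using * by force
  next
    fix e assume "e \<in> (\<lambda>(w, i). {w, i # w}) ` (below d n \<times> {..<d})"
    then obtain w i where "e = {w, i # w}" "w \<in> below d n" "i < d" by auto
    thus "e \<in> {e \<in> tree_edges d. e \<inter> below d n \<noteq> {}}" by (auto simp: tree_edges_def below_def)
  qed
qed

lemma finite_tree_edges_touching_below: "finite {e \<in> tree_edges d. e \<inter> below d n \<noteq> {}}"
  unfolding tree_edges_touching_below by simp

text \<open>Every edge is charged to its parent end, so the value also depends on the spins of
  \<open>level d n\<close>. The site weights \<open>b\<close> stay open so that one summation
  argument covers free and pinned vertices.\<close>

definition ball_weight :: "nat \<Rightarrow> real \<Rightarrow> (nat list \<Rightarrow> spin \<Rightarrow> real) \<Rightarrow> nat \<Rightarrow> (nat list \<Rightarrow> spin) \<Rightarrow> real" where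
  "ball_weight d \<beta> b n \<tau> = (\<Prod>w\<in>below d n. b w (\<tau> w) * (\<Prod>i<d. if \<tau> w = \<tau> (i # w) then \<beta> else 1))"

lemma ball_weight_cong:
  assumes "\<And>w. w \<in> below d (Suc n) \<Longrightarrow> \<tau> w = \<tau>' w"
  shows "ball_weight d \<beta> b n \<tau> = ball_weight d \<beta> b n \<tau>'"
  unfolding ball_weight_def
  using assms Cons_in_below below_mono[of n "Suc n" d]
  by (intro prod.cong refl arg_cong2[where f = "(*)"]) (auto 4 4)

lemma ball_weight_Suc:
  "ball_weight d \<beta> b (Suc n) \<tau> = ball_weight d \<beta> b n \<tau> *
     (\<Prod>w\<in>level d n. b w (\<tau> w) * (\<Prod>i<d. if \<tau> w = \<tau> (i # w) then \<beta> else 1))"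
  unfolding ball_weight_def by (rule prod_below_Suc)

lemma ising_weight_below:
  "ising_weight (tree_edges d) \<beta> lam (below d n) \<tau> =
     ball_weight d \<beta> (\<lambda>_ s. if s = Minus then lam else 1) n \<tau>"
proof -
  have 1: "lam ^ minus_count (below d n) \<tau> = (\<Prod>w\<in>below d n. if \<tau> w = Minus then lam else 1)"
    by (simp add: minus_count_def prod.inter_filter[symmetric])
  let ?f = "\<lambda>(w, i). {w, i # w}" and ?P = "\<lambda>e. \<forall>u\<in>e. \<forall>v\<in>e. \<tau> u = \<tau> v"
  have inj: "inj_on ?f X" for X
    by (auto simp: inj_on_def dest!: tree_edge_inj)
  have "{e \<in> tree_edges d. e \<inter> below d n \<noteq> {} \<and> ?P e} = {e \<in> ?f ` (below d n \<times> {..<d}). ?P e}"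
    unfolding tree_edges_touching_below[symmetric] by blast
  also have "\<dots> = ?f ` {p \<in> below d n \<times> {..<d}. ?P (?f p)}"
    by blast
  also have "(\<lambda>p. ?P (?f p)) = (\<lambda>p. \<tau> (fst p) = \<tau> (snd p # fst p))"
    by (auto simp: fun_eq_iff)
  finally have "equal_edge_count (tree_edges d) (below d n) \<tau> =
      card {p \<in> below d n \<times> {..<d}. \<tau> (fst p) = \<tau> (snd p # fst p)}"
    by (simp add: equal_edge_count_def card_image[OF inj])
  hence "\<beta> ^ equal_edge_count (tree_edges d) (below d n) \<tau> =
      (\<Prod>p\<in>below d n \<times> {..<d}. if \<tau> (fst p) = \<tau> (snd p # fst p) then \<beta> else 1)"
    by (simp add: prod.inter_filter[symmetric])
  also have "\<dots> = (\<Prod>w\<in>below d n. \<Prod>i<d. if \<tau> w = \<tau> (i # w) then \<beta> else 1)"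
    by (simp add: prod.cartesian_product split_def)
  finally show ?thesis using 1 by (simp add: ising_weight_def ball_weight_def prod.distrib)
qed

text \<open>Summing out the spins of the last level.\<close>

lemma sum_ball_weight_step:
  assumes \<phi>: "depends_on (below d (Suc m)) \<phi>"
  shows "(\<Sum>\<tau>\<in>below d (Suc (Suc m)) \<rightarrow>\<^sub>E UNIV. \<phi> \<tau> * (ball_weight d \<beta> b (Suc m) \<tau> * (\<Prod>v\<in>level d (Suc m). a v (\<tau> v)))) =
    (\<Sum>\<tau>\<in>below d (Suc m) \<rightarrow>\<^sub>E UNIV. \<phi> \<tau> * (ball_weight d \<beta> b m \<tau> * (\<Prod>w\<in>level d m. b w (\<tau> w) *
        (\<Prod>i<d. \<Sum>s\<in>UNIV. (if \<tau> w = s then \<beta> else 1) * a (i # w) s))))"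
proof -
  have "(\<Sum>y\<in>level d (Suc m) \<rightarrow>\<^sub>E UNIV. \<phi> (override_on y x (below d (Suc m))) *
      (ball_weight d \<beta> b (Suc m) (override_on y x (below d (Suc m))) *
        (\<Prod>v\<in>level d (Suc m). a v (override_on y x (below d (Suc m)) v)))) =
    \<phi> x * (ball_weight d \<beta> b m x * (\<Prod>w\<in>level d m. b w (x w) *
        (\<Prod>i<d. \<Sum>s\<in>UNIV. (if x w = s then \<beta> else 1) * a (i # w) s)))" (is "(\<Sum>y\<in>_. ?l y) = _") for x
  proof -
    \<comment> \<open>Given the spins \<open>x\<close> above, each vertex of the last level enters
      only through its own factor, \<open>tl v\<close> being its parent. The sum of products thus
      becomes a product of sums.\<close>
    have eq: "?l y = \<phi> x * ball_weight d \<beta> b m x * (\<Prod>w\<in>level d m. b w (x w)) *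
       (\<Prod>v\<in>level d (Suc m). (if x (tl v) = y v then \<beta> else 1) * a v (y v))" for y
    proof -
      let ?o = "override_on y x (below d (Suc m))"
      have 1: "\<phi> ?o = \<phi> x" by (rule depends_onD[OF \<phi>]) simp
      have 2: "ball_weight d \<beta> b m ?o = ball_weight d \<beta> b m x" by (rule ball_weight_cong) simp
      have 3: "?o w = x w" if "w \<in> level d m" for w using that by (simp add: below_Suc)
      have 4: "?o v = y v" if "v \<in> level d (Suc m)" for v
        using that below_Int_level[of "Suc m" "Suc m" d] by (auto simp: override_on_def)
      have "(\<Prod>w\<in>level d m. b w (?o w) * (\<Prod>i<d. if ?o w = ?o (i # w) then \<beta> else 1)) =
         (\<Prod>w\<in>level d m. b w (x w)) * (\<Prod>w\<in>level d m. \<Prod>i<d. if x w = y (i # w) then \<beta> else 1)"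
        unfolding prod.distrib[symmetric] by (intro prod.cong refl) (simp add: 3 4 Cons_in_level)
      also have "(\<Prod>w\<in>level d m. \<Prod>i<d. if x w = y (i # w) then \<beta> else 1) =
         (\<Prod>v\<in>level d (Suc m). if x (tl v) = y v then \<beta> else 1)"
        by (simp add: prod_level_Suc)
      finally show ?thesis
        by (simp add: 1 2 4 ball_weight_Suc prod.distrib mult_ac)
    qed
    have "(\<Sum>y\<in>level d (Suc m) \<rightarrow>\<^sub>E UNIV. ?l y) = \<phi> x * ball_weight d \<beta> b m x * (\<Prod>w\<in>level d m. b w (x w)) *
       (\<Prod>v\<in>level d (Suc m). \<Sum>s\<in>UNIV. (if x (tl v) = s then \<beta> else 1) * a v s)"
      unfolding eq sum_distrib_left[symmetric] by (subst prod_sum_PiE) auto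
    thus ?thesis by (simp add: prod_level_Suc prod.distrib mult_ac)
  qed
  thus ?thesis
    unfolding below_Suc[of d "Suc m"] by (subst sum_PiE_Un) (auto simp: below_Int_level)
qed

lemma sum_pinned_configs:
  fixes F :: "('v \<Rightarrow> spin) \<Rightarrow> real"
  assumes fin: "finite B" and \<Lambda>: "\<Lambda> \<subseteq> B"
  shows "(\<Sum>\<tau>\<in>B \<rightarrow>\<^sub>E UNIV. if \<forall>v\<in>B - \<Lambda>. \<tau> v = \<eta> v then F \<tau> else 0) =
    (\<Sum>\<xi>\<in>\<Lambda> \<rightarrow>\<^sub>E UNIV. F (restrict (override_on \<eta> \<xi> \<Lambda>) B))"
proof -
  have "finite (B \<rightarrow>\<^sub>E (UNIV :: spin set))" using fin by (simp add: finite_PiE)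
  hence "(\<Sum>\<tau>\<in>B \<rightarrow>\<^sub>E UNIV. if \<forall>v\<in>B - \<Lambda>. \<tau> v = \<eta> v then F \<tau> else 0) =
     sum F {\<tau> \<in> B \<rightarrow>\<^sub>E UNIV. \<forall>v\<in>B - \<Lambda>. \<tau> v = \<eta> v}"
    by (simp add: sum.inter_filter)
  also have "\<dots> = (\<Sum>\<xi>\<in>\<Lambda> \<rightarrow>\<^sub>E UNIV. F (restrict (override_on \<eta> \<xi> \<Lambda>) B))"
    by (rule sum.reindex_bij_witness[where j = "\<lambda>\<tau>. restrict \<tau> \<Lambda>" and i = "\<lambda>\<xi>. restrict (override_on \<eta> \<xi> \<Lambda>) B"])
      (use \<Lambda> in \<open>auto simp: fun_eq_iff override_on_def PiE_def extensional_def restrict_def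
         intro!: arg_cong[of _ _ F]\<close>)
  finally show ?thesis .
qed

section \<open>Messages in the presence of pinned vertices\<close>

context antiferro_ising begin

abbreviation "V \<equiv> tree_verts d"
abbreviation "E \<equiv> tree_edges d"

text \<open>This turns a lower bound on the distance of \<open>T\<close> from the root into a lower
  bound on the length of the words in \<open>T\<close>.\<close>

lemma graph_dist_root_le:
  assumes "w \<in> V" shows "graph_dist E [] w \<le> length w"
proof -
  have "([], w) \<in> {(a, b). {a, b} \<in> E} ^^ length w"
    using assms
  proof (induction w)
    case (Cons i w)
    hence "w \<in> V" "{w, i # w} \<in> E" by (auto simp: tree_verts_def tree_edges_def)
    thus ?case using Cons.IH by auto
  qed simp
  thus ?thesis unfolding graph_dist_def by (rule Least_le)
qed

text \<open>Pinning is encoded as weight zero, so that sums run over all configurations of a ball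
  and pinned vertices obey the same recursion as free ones.\<close>

definition site_weight :: "nat list set \<Rightarrow> (nat list \<Rightarrow> spin) \<Rightarrow> nat list \<Rightarrow> spin \<Rightarrow> real" where
  "site_weight S \<eta> w s = (if w \<in> S \<and> s \<noteq> \<eta> w then 0 else if s = Minus then lam else 1)"

text \<open>\<open>msg S \<eta> k w s\<close> is the partition function of the first \<open>k\<close> levels below \<open>w\<close>, given spin \<open>s\<close> at \<open>w\<close>,
  with \<open>S\<close> and the next level pinned to \<open>\<eta>\<close>.\<close>

primrec msg :: "nat list set \<Rightarrow> (nat list \<Rightarrow> spin) \<Rightarrow> nat \<Rightarrow> nat list \<Rightarrow> spin \<Rightarrow> real" where
  "msg S \<eta> 0 w s = (if s = \<eta> w then 1 else 0)"
| "msg S \<eta> (Suc k) w s = site_weight S \<eta> w s *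
     (\<Prod>i<d. \<Sum>s'\<in>UNIV. (if s = s' then \<beta> else 1) * msg S \<eta> k (i # w) s')"

lemma ball_weight_site_weight:
  "ball_weight d \<beta> (site_weight S \<eta>) n \<tau> =
     (if \<forall>w\<in>below d n \<inter> S. \<tau> w = \<eta> w then ising_weight E \<beta> lam (below d n) \<tau> else 0)"
proof (cases "\<forall>w\<in>below d n \<inter> S. \<tau> w = \<eta> w")
  case True
  thus ?thesis unfolding ising_weight_below ball_weight_def
    by (auto intro!: prod.cong simp: site_weight_def)
next
  case False
  hence "\<exists>w\<in>below d n. site_weight S \<eta> w (\<tau> w) * (\<Prod>i<d. if \<tau> w = \<tau> (i # w) then \<beta> else 1) = 0"
    by (auto simp: site_weight_def)
  hence "ball_weight d \<beta> (site_weight S \<eta>) n \<tau> = 0"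
    unfolding ball_weight_def by (subst prod_zero_iff) auto
  thus ?thesis using False by auto
qed

text \<open>The left-hand side does not involve \<open>m\<close>. As \<open>m\<close> decreases from
  \<open>n\<close>, each step sums out one level and turns its spins into messages one level deeper.
  The factor \<open>outer_weight\<close> completes the weight of the unpinned vertices to that of
  the full ball, which has product form.\<close>

lemma sum_finite_volume:
  fixes S \<eta> n
  defines "\<Lambda> \<equiv> below d n - S"
  assumes "m \<le> n" and \<phi>: "depends_on (below d (Suc m)) \<phi>"
  shows "(\<Sum>\<xi>\<in>\<Lambda> \<rightarrow>\<^sub>E UNIV. \<phi> (override_on \<eta> \<xi> \<Lambda>) * ising_weight E \<beta> lam \<Lambda> (override_on \<eta> \<xi> \<Lambda>)) *
      outer_weight E \<beta> lam \<Lambda> (below d n) \<eta> =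
    (\<Sum>\<tau>\<in>below d (Suc m) \<rightarrow>\<^sub>E UNIV. \<phi> \<tau> * (ball_weight d \<beta> (site_weight S \<eta>) m \<tau> *
        (\<Prod>v\<in>level d m. msg S \<eta> (n - m) v (\<tau> v))))"
  using \<open>m \<le> n\<close> \<phi>
proof (induction m rule: inc_induct)
  \<comment> \<open>Messages of depth 0 are indicators that pin level \<open>n\<close> to
    \<open>\<eta>\<close>, and the zero site weights pin \<open>S\<close>; the sum over
    \<open>\<Lambda>\<close> remains.\<close>
  case base
  let ?B = "below d (Suc n)"
  have sub: "\<Lambda> \<subseteq> below d n" "\<Lambda> \<subseteq> ?B" by (auto simp: \<Lambda>_def below_Suc)
  have lev: "(\<Prod>v\<in>level d n. if \<tau> v = \<eta> v then 1 else 0 :: real) = (if \<forall>v\<in>level d n. \<tau> v = \<eta> v then 1 else 0)" for \<tau>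
    by (auto simp: prod_zero_iff)
  have cond: "(\<forall>v\<in>?B - \<Lambda>. \<tau> v = \<eta> v) \<longleftrightarrow> (\<forall>w\<in>below d n \<inter> S. \<tau> w = \<eta> w) \<and> (\<forall>v\<in>level d n. \<tau> v = \<eta> v)" for \<tau>
    using below_Int_level[of n n d] by (auto simp: \<Lambda>_def below_Suc)
  have "(\<Sum>\<tau>\<in>?B \<rightarrow>\<^sub>E UNIV. \<phi> \<tau> * (ball_weight d \<beta> (site_weight S \<eta>) n \<tau> *
        (\<Prod>v\<in>level d n. msg S \<eta> (n - n) v (\<tau> v)))) =
     (\<Sum>\<tau>\<in>?B \<rightarrow>\<^sub>E UNIV. if \<forall>v\<in>?B - \<Lambda>. \<tau> v = \<eta> v then \<phi> \<tau> * ising_weight E \<beta> lam (below d n) \<tau> else 0)"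
    unfolding ball_weight_site_weight cond by (intro sum.cong refl) (auto simp: lev)
  also have "\<dots> = (\<Sum>\<xi>\<in>\<Lambda> \<rightarrow>\<^sub>E UNIV. \<phi> (restrict (override_on \<eta> \<xi> \<Lambda>) ?B) *
      ising_weight E \<beta> lam (below d n) (restrict (override_on \<eta> \<xi> \<Lambda>) ?B))"
    by (rule sum_pinned_configs[OF _ sub(2)]) simp
  also have "\<dots> = (\<Sum>\<xi>\<in>\<Lambda> \<rightarrow>\<^sub>E UNIV. \<phi> (override_on \<eta> \<xi> \<Lambda>) * (ising_weight E \<beta> lam \<Lambda> (override_on \<eta> \<xi> \<Lambda>) *
      outer_weight E \<beta> lam \<Lambda> (below d n) \<eta>))"
  proof (intro sum.cong refl arg_cong2[where f = "(*)"])
    fix \<xi>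
    show "\<phi> (restrict (override_on \<eta> \<xi> \<Lambda>) ?B) = \<phi> (override_on \<eta> \<xi> \<Lambda>)"
      by (rule depends_onD[OF base]) simp
    have "ising_weight E \<beta> lam (below d n) (restrict (override_on \<eta> \<xi> \<Lambda>) ?B) =
        ising_weight E \<beta> lam (below d n) (override_on \<eta> \<xi> \<Lambda>)"
      unfolding ising_weight_below by (rule ball_weight_cong) simp
    also have "\<dots> = ising_weight E \<beta> lam \<Lambda> (override_on \<eta> \<xi> \<Lambda>) * outer_weight E \<beta> lam \<Lambda> (below d n) \<eta>"
      using ising_weight_superset[OF _ sub(1) finite_tree_edges_touching_below]
      by (simp add: outer_weight_override)
    finally show "ising_weight E \<beta> lam (below d n) (restrict (override_on \<eta> \<xi> \<Lambda>) ?B) = \<dots>" .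
  qed
  finally show ?case by (simp add: sum_distrib_right mult.assoc)
next
  case (step m)
  have \<phi>': "depends_on (below d (Suc (Suc m))) \<phi>"
    using step.prems by (rule depends_on_mono) (rule below_mono, simp)
  have "n - m = Suc (n - Suc m)" using step.hyps by simp
  thus ?case unfolding step.IH[OF \<phi>']
    by (simp add: sum_ball_weight_step[OF step.prems])
qed

lemma site_weight_nonneg: "0 \<le> site_weight S \<eta> w s"
  using lam_pos by (simp add: site_weight_def)

lemma msg_nonneg: "0 \<le> msg S \<eta> k w s"
  using beta_pos
  by (induction k arbitrary: w s) (auto intro!: mult_nonneg_nonneg site_weight_nonneg prod_nonneg sum_nonneg)

text \<open>Pinning can make one of the two messages vanish, so only their sum is positive. Since
  \<open>\<beta> > 0\<close>, a child compatible with one spin leaves both spins of its parent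
  possible.\<close>

lemma msg_sum_pos: "0 < msg S \<eta> k w Plus + msg S \<eta> k w Minus"
proof (induction k arbitrary: w)
  case 0
  show ?case by (cases "\<eta> w") auto
next
  case (Suc k)
  have *: "0 < (\<Prod>i<d. \<Sum>s'\<in>UNIV. (if s = s' then \<beta> else 1) * msg S \<eta> k (i # w) s')" for s
  proof (rule prod_pos)
    fix i
    have "0 < \<beta> * (msg S \<eta> k (i # w) Plus + msg S \<eta> k (i # w) Minus)"
      using Suc beta_pos by simp
    also have "\<dots> \<le> (\<Sum>s'\<in>UNIV. (if s = s' then \<beta> else 1) * msg S \<eta> k (i # w) s')"
      using mult_left_le_one_le[of "msg S \<eta> k (i # w) Plus" \<beta>] mult_left_le_one_le[of "msg S \<eta> k (i # w) Minus" \<beta>]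
        msg_nonneg beta_pos beta_less by (cases s) (auto simp: sum_spin distrib_left)
    finally show "0 < (\<Sum>s'\<in>UNIV. (if s = s' then \<beta> else 1) * msg S \<eta> k (i # w) s')" .
  qed
  have "msg S \<eta> (Suc k) w Plus > 0 \<or> msg S \<eta> (Suc k) w Minus > 0"
    using lam_pos *[of Plus] *[of Minus] by (cases "\<eta> w") (auto simp: site_weight_def)
  thus ?case
    using msg_nonneg by (auto simp del: msg.simps intro: add_pos_nonneg add_nonneg_pos)
qed

text \<open>This is \<open>ln (ising_h \<beta> x)\<close> for \<open>x\<close> the normalised plus
  message. It is the logarithm of the ratio by which the child favours minus over plus at its
  parent.\<close>

definition log_msg :: "nat list set \<Rightarrow> (nat list \<Rightarrow> spin) \<Rightarrow> nat \<Rightarrow> nat list \<Rightarrow> real" where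
  "log_msg S \<eta> k w = ln ((msg S \<eta> k w Plus + \<beta> * msg S \<eta> k w Minus) / (\<beta> * msg S \<eta> k w Plus + msg S \<eta> k w Minus))"

lemma msg_mixed_pos:
  "0 < msg S \<eta> k w Plus + \<beta> * msg S \<eta> k w Minus" "0 < \<beta> * msg S \<eta> k w Plus + msg S \<eta> k w Minus"
proof -
  have "0 < msg S \<eta> k w Plus \<or> 0 < msg S \<eta> k w Minus"
    using msg_sum_pos[of S \<eta> k w] by linarith
  thus "0 < msg S \<eta> k w Plus + \<beta> * msg S \<eta> k w Minus" "0 < \<beta> * msg S \<eta> k w Plus + msg S \<eta> k w Minus"
    using beta_pos msg_nonneg by (auto intro: add_pos_nonneg add_nonneg_pos)
qed

lemma exp_log_msg:
  "exp (log_msg S \<eta> k w) = (msg S \<eta> k w Plus + \<beta> * msg S \<eta> k w Minus) / (\<beta> * msg S \<eta> k w Plus + msg S \<eta> k w Minus)"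
  unfolding log_msg_def using msg_mixed_pos by (intro exp_ln divide_pos_pos)

lemma log_msg_pinned:
  assumes "msg S \<eta> k w s = 0"
  shows "log_msg S \<eta> k w = (if s = Minus then umax else - umax)"
proof (cases s)
  case Plus
  hence "msg S \<eta> k w Minus > 0" using assms msg_sum_pos[of S \<eta> k w] by simp
  thus ?thesis using assms Plus by (simp add: log_msg_def umax_def)
next
  case Minus
  hence "msg S \<eta> k w Plus > 0" using assms msg_sum_pos[of S \<eta> k w] by simp
  thus ?thesis using assms Minus beta_pos by (simp add: log_msg_def umax_def ln_div)
qed

lemma log_msg_0: "log_msg S \<eta> 0 w = (if \<eta> w = Plus then umax else - umax)"
  using log_msg_pinned[of S \<eta> 0 w "if \<eta> w = Plus then Minus else Plus"]
  by (cases "\<eta> w") auto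

lemma log_msg_Suc:
  "log_msg S \<eta> (Suc k) w = (if w \<in> S then if \<eta> w = Plus then umax else - umax
     else relay (ln lam + (\<Sum>i<d. log_msg S \<eta> k (i # w))))"
proof (cases "w \<in> S")
  case True
  thus ?thesis
    using log_msg_pinned[of S \<eta> "Suc k" w "if \<eta> w = Plus then Minus else Plus"]
    by (cases "\<eta> w") (auto simp: site_weight_def)
next
  case False
  \<comment> \<open>\<open>p i\<close> and \<open>q i\<close> are the sums over the spin of child
    \<open>i\<close> when the parent is minus and plus, so \<open>lam * (P / Q)\<close> is the ratio
    of the minus and plus messages of \<open>w\<close>.\<close>
  define p q where "p i = msg S \<eta> k (i # w) Plus + \<beta> * msg S \<eta> k (i # w) Minus"
    and "q i = \<beta> * msg S \<eta> k (i # w) Plus + msg S \<eta> k (i # w) Minus" for i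
  have pq: "p i > 0" "q i > 0" for i using msg_mixed_pos by (auto simp: p_def q_def)
  define P Q where "P = (\<Prod>i<d. p i)" and "Q = (\<Prod>i<d. q i)"
  have PQ: "P > 0" "Q > 0" using pq by (auto simp: P_def Q_def intro: prod_pos)
  have e: "exp (ln lam + (\<Sum>i<d. log_msg S \<eta> k (i # w))) = lam * (P / Q)"
    using lam_pos by (simp add: exp_add exp_sum exp_log_msg P_def Q_def prod_dividef p_def q_def)
  have "msg S \<eta> (Suc k) w Plus = Q" "msg S \<eta> (Suc k) w Minus = lam * P"
    using False by (simp_all add: site_weight_def sum_spin P_def Q_def p_def q_def)
  hence "log_msg S \<eta> (Suc k) w = ln ((Q + \<beta> * (lam * P)) / (\<beta> * Q + lam * P))"
    by (simp add: log_msg_def)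
  also have "(Q + \<beta> * (lam * P)) / (\<beta> * Q + lam * P) = (1 + \<beta> * (lam * (P / Q))) / (\<beta> + lam * (P / Q))"
    using PQ by (simp add: divide_simps)
  finally show ?thesis using False e by (simp add: relay_def)
qed

lemma abs_log_msg_le: "\<bar>log_msg S \<eta> k w\<bar> \<le> umax"
  using umax_pos abs_relay_le by (cases k) (auto simp: log_msg_0 log_msg_Suc)

text \<open>The inverse of \<open>x \<mapsto> ln (ising_h \<beta> x)\<close>, leading back to
  probabilities.\<close>

definition plus_of :: "real \<Rightarrow> real" where
  "plus_of u = (exp u - \<beta>) / ((1 - \<beta>) * (1 + exp u))"

lemma plus_of_log_msg:
  "msg S \<eta> k w Plus / (msg S \<eta> k w Plus + msg S \<eta> k w Minus) = plus_of (log_msg S \<eta> k w)"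
proof -
  define p q where "p = msg S \<eta> k w Plus" and "q = msg S \<eta> k w Minus"
  have pos: "p + q > 0" "p + \<beta> * q > 0" "\<beta> * p + q > 0"
    using msg_sum_pos msg_mixed_pos by (auto simp: p_def q_def)
  have b: "1 - \<beta> \<noteq> 0" "1 + \<beta> \<noteq> 0" using beta_pos beta_less by auto
  have "exp (log_msg S \<eta> k w) - \<beta> = p * (1 - \<beta>) * (1 + \<beta>) / (\<beta> * p + q)"
    unfolding exp_log_msg p_def[symmetric] q_def[symmetric] using pos
    by (simp add: divide_simps) (simp add: algebra_simps)
  moreover have "1 + exp (log_msg S \<eta> k w) = (1 + \<beta>) * (p + q) / (\<beta> * p + q)"
    unfolding exp_log_msg p_def[symmetric] q_def[symmetric] using pos
    by (simp add: divide_simps) (simp add: algebra_simps)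
  ultimately have "plus_of (log_msg S \<eta> k w) =
      (p * (1 - \<beta>) * (1 + \<beta>) / (\<beta> * p + q)) / ((1 - \<beta>) * ((1 + \<beta>) * (p + q) / (\<beta> * p + q)))"
    unfolding plus_of_def by (simp only:)
  also have "\<dots> = p / (p + q)" using pos b by (simp add: divide_simps)
  finally have "plus_of (log_msg S \<eta> k w) = p / (p + q)" .
  thus ?thesis by (simp add: p_def q_def)
qed

lemma plus_of_lipschitz: "\<bar>plus_of u - plus_of v\<bar> \<le> (1 + \<beta>) / (1 - \<beta>) * \<bar>u - v\<bar>"
proof -
  have D: "(plus_of has_real_derivative (1 + \<beta>) / (1 - \<beta>) * (exp x / (1 + exp x)\<^sup>2)) (at x)" for x
  proof -
    have pos: "1 + exp x > 0" by (simp add: add_pos_pos)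
    have eq: "plus_of = (\<lambda>u. (1 - (1 + \<beta>) / (1 + exp u)) / (1 - \<beta>))"
    proof
      fix u :: real
      have "1 + exp u > 0" "1 - \<beta> > 0" using beta_less by (auto intro: add_pos_pos)
      thus "plus_of u = (1 - (1 + \<beta>) / (1 + exp u)) / (1 - \<beta>)"
        by (simp add: plus_of_def field_simps)
    qed
    have "((\<lambda>u. 1 - (1 + \<beta>) / (1 + exp u)) has_real_derivative (1 + \<beta>) * (exp x / (1 + exp x)\<^sup>2)) (at x)"
      using pos by (auto intro!: derivative_eq_intros simp: power2_eq_square)
    thus ?thesis
      unfolding eq by (intro DERIV_cong[OF DERIV_cdivide]) (use pos beta_less in \<open>auto simp: divide_simps\<close>)
  qed
  have "norm (plus_of u - plus_of v) \<le> (1 + \<beta>) / (1 - \<beta>) * norm (u - v)"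
  proof (rule field_differentiable_bound[where S = UNIV])
    show "(plus_of has_field_derivative (1 + \<beta>) / (1 - \<beta>) * (exp x / (1 + exp x)\<^sup>2)) (at x within UNIV)" for x
      using D by simp
    show "norm ((1 + \<beta>) / (1 - \<beta>) * (exp x / (1 + exp x)\<^sup>2)) \<le> (1 + \<beta>) / (1 - \<beta>)" for x
    proof -
      have "exp x / (1 + exp x)\<^sup>2 \<le> 1"
        by (simp add: power2_eq_square divide_simps add_pos_pos) (simp add: algebra_simps add_pos_pos less_imp_le)
      moreover have "0 \<le> (1 + \<beta>) / (1 - \<beta>)" using beta_pos beta_less by simp
      ultimately have "(1 + \<beta>) / (1 - \<beta>) * (exp x / (1 + exp x)\<^sup>2) \<le> (1 + \<beta>) / (1 - \<beta>)"
        "0 \<le> (1 + \<beta>) / (1 - \<beta>) * (exp x / (1 + exp x)\<^sup>2)"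
        by (auto intro!: mult_left_le mult_nonneg_nonneg simp del: times_divide_eq_left times_divide_eq_right)
      thus ?thesis by (simp only: real_norm_def abs_of_nonneg)
    qed
  qed auto
  thus ?thesis by simp
qed

end

section \<open>Strong spatial mixing and uniqueness\<close>

definition cylinder :: "'v set \<Rightarrow> 'v set \<Rightarrow> ('v \<Rightarrow> spin) \<Rightarrow> ('v \<Rightarrow> spin) set" where
  "cylinder V K \<kappa> = {\<tau> \<in> space (config_space V). \<forall>v\<in>K. \<tau> v = \<kappa> v}"

lemma space_config_space: "space (config_space V) = V \<rightarrow>\<^sub>E UNIV"
  by (simp add: config_space_def space_PiM)

lemma config_space_finite: "finite J \<Longrightarrow> config_space J = count_space (J \<rightarrow>\<^sub>E (UNIV :: spin set))"
  unfolding config_space_def by (rule count_space_PiM_finite) (auto intro: countable_finite)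

lemma measurable_restrict_config: "J \<subseteq> I \<Longrightarrow> (\<lambda>\<eta>. restrict \<eta> J) \<in> measurable (config_space I) (config_space J)"
  unfolding config_space_def by (rule measurable_restrict_subset)

text \<open>On finitely many sites the configuration space is discrete. Leaving \<open>M\<close>
  general allows the smaller \<open>outside_algebra\<close> as well as the full algebra.\<close>

lemma measurable_depends_on:
  fixes \<phi> :: "('v \<Rightarrow> spin) \<Rightarrow> 'b"
  assumes J: "finite J" and \<phi>: "depends_on J \<phi>"
    and r: "(\<lambda>\<eta>. restrict \<eta> J) \<in> measurable M (config_space J)"
    and N: "\<phi> \<in> UNIV \<rightarrow> space N"
  shows "\<phi> \<in> measurable M N"
proof -
  have "\<phi> \<in> measurable (config_space J) N"
    using N unfolding config_space_finite[OF J] by auto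
  from measurable_compose[OF r this] have "(\<lambda>\<eta>. \<phi> (restrict \<eta> J)) \<in> measurable M N" .
  moreover have "\<phi> (restrict \<eta> J) = \<phi> \<eta>" for \<eta> by (rule depends_onD[OF \<phi>]) simp
  ultimately show ?thesis by simp
qed

lemma cylinder_in_sets:
  assumes "finite K" "K \<subseteq> V"
  shows "cylinder V K \<kappa> \<in> sets (config_space V)"
proof -
  have "depends_on K (\<lambda>\<tau>. \<forall>v\<in>K. \<tau> v = \<kappa> v)" by (auto simp: depends_on_def)
  hence "(\<lambda>\<tau>. \<forall>v\<in>K. \<tau> v = \<kappa> v) \<in> measurable (config_space V) (count_space UNIV)"
    by (rule measurable_depends_on[OF assms(1)]) (use measurable_restrict_config[OF assms(2)] in auto)
  thus ?thesis unfolding cylinder_def by measurable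
qed

text \<open>An event on the sites \<open>J\<close> is a finite disjoint union of cylinders over any
  larger finite \<open>K\<close>, so a cofinal family of sets \<open>K\<close> suffices. On the tree
  these can be balls or balls with a finite set removed.\<close>

lemma measure_eqI_cylinders:
  fixes P Q :: "('v \<Rightarrow> spin) measure"
  assumes sets: "sets P = sets (config_space V)" "sets Q = sets (config_space V)"
    and fin: "finite_measure P"
    and eq: "\<And>J. finite J \<Longrightarrow> J \<subseteq> V \<Longrightarrow> \<exists>K. finite K \<and> J \<subseteq> K \<and> K \<subseteq> V \<and>
       (\<forall>\<kappa>. emeasure P (cylinder V K \<kappa>) = emeasure Q (cylinder V K \<kappa>))"
  shows "P = Q"
proof (rule measure_eqI_PiM_infinite[OF sets[unfolded config_space_def] _ fin])
  fix A :: "'v \<Rightarrow> spin set" and J assume J: "finite J" "J \<subseteq> V"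
  obtain K where K: "finite K" "J \<subseteq> K" "K \<subseteq> V"
    "\<And>\<kappa>. emeasure P (cylinder V K \<kappa>) = emeasure Q (cylinder V K \<kappa>)"
    using eq[OF J] by blast
  define I where "I = {\<kappa> \<in> K \<rightarrow>\<^sub>E (UNIV :: spin set). \<forall>v\<in>J. \<kappa> v \<in> A v}"
  have finI: "finite I" using K(1) by (simp add: I_def finite_PiE)
  have emb: "prod_emb V (\<lambda>_. count_space UNIV) J (Pi\<^sub>E J A) = (\<Union>\<kappa>\<in>I. cylinder V K \<kappa>)"
  proof (intro equalityI subsetI)
    fix \<tau> assume t: "\<tau> \<in> prod_emb V (\<lambda>_. count_space UNIV) J (Pi\<^sub>E J A)"
    hence "restrict \<tau> K \<in> I" "\<tau> \<in> cylinder V K (restrict \<tau> K)"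
      using K J by (auto simp: I_def prod_emb_iff cylinder_def space_config_space PiE_def Pi_iff)
    thus "\<tau> \<in> (\<Union>\<kappa>\<in>I. cylinder V K \<kappa>)" by blast
  next
    fix \<tau> assume "\<tau> \<in> (\<Union>\<kappa>\<in>I. cylinder V K \<kappa>)"
    thus "\<tau> \<in> prod_emb V (\<lambda>_. count_space UNIV) J (Pi\<^sub>E J A)"
      using K J by (auto simp: I_def prod_emb_iff cylinder_def space_config_space PiE_def Pi_iff subset_iff)
  qed
  have disj: "disjoint_family_on (cylinder V K) I"
  proof (unfold disjoint_family_on_def, intro ballI impI)
    fix \<kappa> \<kappa>' assume "\<kappa> \<in> I" "\<kappa>' \<in> I" "\<kappa> \<noteq> \<kappa>'"
    moreover have "I \<subseteq> K \<rightarrow>\<^sub>E UNIV" by (auto simp: I_def)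
    ultimately obtain v where "v \<in> K" "\<kappa> v \<noteq> \<kappa>' v" by (meson PiE_ext subsetD)
    thus "cylinder V K \<kappa> \<inter> cylinder V K \<kappa>' = {}" by (auto simp: cylinder_def)
  qed
  have cyl: "cylinder V K ` I \<subseteq> sets (config_space V)"
    using cylinder_in_sets[OF K(1,3)] by blast
  have "emeasure P (\<Union>\<kappa>\<in>I. cylinder V K \<kappa>) = (\<Sum>\<kappa>\<in>I. emeasure P (cylinder V K \<kappa>))"
    by (rule sum_emeasure[symmetric]) (use cyl disj finI sets in auto)
  also have "\<dots> = (\<Sum>\<kappa>\<in>I. emeasure Q (cylinder V K \<kappa>))"
    by (intro sum.cong refl K(4))
  also have "\<dots> = emeasure Q (\<Union>\<kappa>\<in>I. cylinder V K \<kappa>)"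
    by (rule sum_emeasure) (use cyl disj finI sets in auto)
  finally show "emeasure P (prod_emb V (\<lambda>_. count_space UNIV) J (Pi\<^sub>E J A)) =
      emeasure Q (prod_emb V (\<lambda>_. count_space UNIV) J (Pi\<^sub>E J A))"
    unfolding emb .
qed

lemma subalgebra_outside:
  assumes "sets \<mu> = sets (config_space V)"
  shows "subalgebra \<mu> (outside_algebra V \<Lambda>)"
proof -
  have sp: "space \<mu> = space (config_space V)" using assms by (rule sets_eq_imp_space_eq)
  have "(\<lambda>\<eta>. restrict \<eta> (V - \<Lambda>)) \<in> measurable \<mu> (config_space (V - \<Lambda>))"
    using measurable_restrict_config[of "V - \<Lambda>" V] measurable_cong_sets[OF assms refl] by auto
  from sets_image_in_sets[OF sp this] show ?thesis
    by (simp add: subalgebra_def outside_algebra_def sp)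
qed

text \<open>\<open>g\<close> is a sum of conditional expectations, which brings its own
  measurability and integrability; the explicit finite-volume probability enters only almost
  everywhere.\<close>

lemma gibbs_measureE_event:
  assumes G: "conditioned_gibbs_measure V E \<beta> lam S \<sigma> \<mu>"
    and \<Lambda>: "finite \<Lambda>" "\<Lambda> \<subseteq> V - S" and X: "X \<subseteq> \<Lambda> \<rightarrow>\<^sub>E UNIV"
  obtains g where "integrable \<mu> g" "(\<integral>\<eta>. g \<eta> \<partial>\<mu>) = measure \<mu> {\<eta> \<in> space \<mu>. restrict \<eta> \<Lambda> \<in> X}"
    "AE \<eta> in \<mu>. g \<eta> = (\<Sum>\<xi>\<in>X. ising_spec E \<beta> lam \<Lambda> \<xi> \<eta>)"
proof -
  have sets: "sets \<mu> = sets (config_space V)" and "prob_space \<mu>"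
    using G by (auto simp: conditioned_gibbs_measure_def)
  interpret prob_space \<mu> by fact
  interpret finite_measure_subalgebra \<mu> "outside_algebra V \<Lambda>"
    by unfold_locales (rule subalgebra_outside[OF sets])
  have sp: "space \<mu> = space (config_space V)" using sets by (rule sets_eq_imp_space_eq)
  let ?C = "\<lambda>\<xi>. {\<tau> \<in> space \<mu>. \<forall>v\<in>\<Lambda>. \<tau> v = \<xi> v}"
  have C: "?C \<xi> \<in> sets \<mu>" for \<xi>
    using cylinder_in_sets[of \<Lambda> V \<xi>] \<Lambda> by (auto simp: cylinder_def sets sp)
  have int: "integrable \<mu> (indicator (?C \<xi>) :: _ \<Rightarrow> real)" for \<xi>
    using C emeasure_finite by (intro integrable_real_indicator) (auto simp: less_top[symmetric])
  define g where "g \<eta> = (\<Sum>\<xi>\<in>X. real_cond_exp \<mu> (outside_algebra V \<Lambda>) (indicator (?C \<xi>)) \<eta>)" for \<eta>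
  have fX: "finite X" using X \<Lambda> by (auto intro: finite_subset simp: finite_PiE)
  show ?thesis
  proof (rule that[of g])
    show "integrable \<mu> g"
      unfolding g_def by (intro Bochner_Integration.integrable_sum real_cond_exp_int(1) int)
    have "(\<integral>\<eta>. g \<eta> \<partial>\<mu>) = (\<Sum>\<xi>\<in>X. measure \<mu> (?C \<xi>))"
      unfolding g_def using int real_cond_exp_int[OF int]
      by (subst Bochner_Integration.integral_sum) (auto simp: sets.Int_space_eq2[OF C])
    also have "\<dots> = measure \<mu> (\<Union>\<xi>\<in>X. ?C \<xi>)"
    proof (rule finite_measure_finite_Union[symmetric, OF fX])
      show "disjoint_family_on ?C X"
      proof (unfold disjoint_family_on_def, intro ballI impI)
        fix \<xi> \<xi>' assume "\<xi> \<in> X" "\<xi>' \<in> X" "\<xi> \<noteq> \<xi>'"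
        then obtain v where "v \<in> \<Lambda>" "\<xi> v \<noteq> \<xi>' v" using X by (meson PiE_ext subsetD)
        thus "?C \<xi> \<inter> ?C \<xi>' = {}" by auto
      qed
    qed (use C in auto)
    also have "(\<Union>\<xi>\<in>X. ?C \<xi>) = {\<eta> \<in> space \<mu>. restrict \<eta> \<Lambda> \<in> X}"
    proof (intro equalityI subsetI)
      fix \<tau> assume "\<tau> \<in> (\<Union>\<xi>\<in>X. ?C \<xi>)"
      then obtain \<xi> where "\<xi> \<in> X" "\<tau> \<in> ?C \<xi>" by blast
      moreover from this have "restrict \<tau> \<Lambda> = \<xi>"
        using X by (intro PiE_ext[of _ \<Lambda> "\<lambda>_. UNIV"]) auto
      ultimately show "\<tau> \<in> {\<eta> \<in> space \<mu>. restrict \<eta> \<Lambda> \<in> X}" by auto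
    next
      fix \<tau> assume "\<tau> \<in> {\<eta> \<in> space \<mu>. restrict \<eta> \<Lambda> \<in> X}"
      thus "\<tau> \<in> (\<Union>\<xi>\<in>X. ?C \<xi>)" by (auto intro!: bexI[of _ "restrict \<tau> \<Lambda>"])
    qed
    finally show "(\<integral>\<eta>. g \<eta> \<partial>\<mu>) = measure \<mu> {\<eta> \<in> space \<mu>. restrict \<eta> \<Lambda> \<in> X}" .
    have "AE \<eta> in \<mu>. real_cond_exp \<mu> (outside_algebra V \<Lambda>) (indicator (?C \<xi>)) \<eta> = ising_spec E \<beta> lam \<Lambda> \<xi> \<eta>"
      if "\<xi> \<in> X" for \<xi>
    proof -
      have "finite \<Lambda> \<and> \<Lambda> \<subseteq> V - S \<and> \<xi> \<in> \<Lambda> \<rightarrow>\<^sub>E UNIV" using \<Lambda> X that by blast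
      thus ?thesis using G unfolding conditioned_gibbs_measure_def by blast
    qed
    hence "AE \<eta> in \<mu>. \<forall>\<xi>\<in>X. real_cond_exp \<mu> (outside_algebra V \<Lambda>) (indicator (?C \<xi>)) \<eta> = ising_spec E \<beta> lam \<Lambda> \<xi> \<eta>"
      using fX by (intro AE_finite_allI)
    thus "AE \<eta> in \<mu>. g \<eta> = (\<Sum>\<xi>\<in>X. ising_spec E \<beta> lam \<Lambda> \<xi> \<eta>)"
      by eventually_elim (simp add: g_def)
  qed
qed

lemma plus_prob_pinned:
  assumes G: "conditioned_gibbs_measure V E \<beta> lam S \<sigma> \<mu>" and "v \<in> S" "S \<subseteq> V"
  shows "plus_prob v \<mu> = (if \<sigma> v = Plus then 1 else 0)"
proof -
  interpret prob_space \<mu> using G by (simp add: conditioned_gibbs_measure_def)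
  have sets: "sets \<mu> = sets (config_space V)"
    using G by (simp add: conditioned_gibbs_measure_def)
  hence sp: "space \<mu> = space (config_space V)" by (rule sets_eq_imp_space_eq)
  have "AE \<eta> in \<mu>. \<forall>v\<in>S. \<eta> v = \<sigma> v" using G by (simp add: conditioned_gibbs_measure_def)
  hence AE: "AE \<eta> in \<mu>. \<eta> v = \<sigma> v" by eventually_elim (use assms in auto)
  have m: "{\<eta> \<in> space \<mu>. \<eta> v = Plus} \<in> sets \<mu>"
    using cylinder_in_sets[of "{v}" V "\<lambda>_. Plus"] assms(2,3) by (auto simp: cylinder_def sets sp)
  show ?thesis
  proof (cases "\<sigma> v = Plus")
    case True
    have "prob {\<eta> \<in> space \<mu>. \<eta> v = Plus} = 1"
      using AE True by (subst prob_Collect_eq_1[OF m]) auto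
    thus ?thesis using True by (simp add: plus_prob_def)
  next
    case False
    have "prob {\<eta> \<in> space \<mu>. \<eta> v = Plus} = 0"
      by (subst prob_Collect_eq_0[OF m]) (use AE False in \<open>auto elim: eventually_mono\<close>)
    thus ?thesis using False by (simp add: plus_prob_def)
  qed
qed

definition spin_prob :: "real \<Rightarrow> spin \<Rightarrow> real" where
  "spin_prob x s = (if s = Plus then x else 1 - x)"

section \<open>Finite-volume marginals through messages\<close>

context antiferro_ising begin

text \<open>Numerator and normalising sum of the specification, both multiplied by the same
  \<open>outer_weight\<close>, are instances of \<open>sum_finite_volume\<close> at
  \<open>m = 0\<close>, where only the root is left.\<close>

lemma sum_ising_spec_root:
  assumes "[] \<notin> S" "n > 0"
  defines "\<Lambda> \<equiv> below d n - S"
  shows "(\<Sum>\<xi>\<in>{\<xi> \<in> \<Lambda> \<rightarrow>\<^sub>E UNIV. \<xi> [] = Plus}. ising_spec E \<beta> lam \<Lambda> \<xi> \<eta>) = plus_of (log_msg S \<eta> n [])"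
proof -
  let ?w = "\<lambda>\<xi>. ising_weight E \<beta> lam \<Lambda> (override_on \<eta> \<xi> \<Lambda>)"
  let ?o = "outer_weight E \<beta> lam \<Lambda> (below d n) \<eta>"
  have opos: "?o > 0" using outer_weight_pos beta_pos lam_pos by blast
  have b1: "below d (Suc 0) = {[]}" by (simp add: below_Suc)
  have sum1: "(\<Sum>\<tau>\<in>{[]} \<rightarrow>\<^sub>E UNIV. F (\<tau> [])) = (\<Sum>s\<in>UNIV. F s)" for F :: "spin \<Rightarrow> real"
    by (rule sum.reindex_bij_witness[where i = "\<lambda>s. \<lambda>v\<in>{[]}. s" and j = "\<lambda>\<tau>. \<tau> []"])
      (auto simp: PiE_def extensional_def fun_eq_iff)
  have key: "(\<Sum>\<xi>\<in>\<Lambda> \<rightarrow>\<^sub>E UNIV. \<phi> (override_on \<eta> \<xi> \<Lambda> []) * ?w \<xi>) * ?o = (\<Sum>s\<in>UNIV. \<phi> s * msg S \<eta> n [] s)"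
    for \<phi> :: "spin \<Rightarrow> real"
  proof -
    have "depends_on (below d (Suc 0)) (\<lambda>\<tau>. \<phi> (\<tau> []))" by (auto simp: depends_on_def b1)
    from sum_finite_volume[where S = S and \<eta> = \<eta> and n = n, OF _ this, folded \<Lambda>_def]
    show ?thesis by (simp add: b1 ball_weight_def sum1[of "\<lambda>s. \<phi> s * msg S \<eta> n [] s"])
  qed
  have root: "[] \<in> \<Lambda>" using assms by (auto simp: \<Lambda>_def below_def tree_verts_def)
  have fin: "finite (\<Lambda> \<rightarrow>\<^sub>E (UNIV :: spin set))" by (simp add: \<Lambda>_def finite_PiE)
  have "(\<Sum>\<xi>\<in>{\<xi> \<in> \<Lambda> \<rightarrow>\<^sub>E UNIV. \<xi> [] = Plus}. ?w \<xi>) =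
      (\<Sum>\<xi>\<in>\<Lambda> \<rightarrow>\<^sub>E UNIV. (if override_on \<eta> \<xi> \<Lambda> [] = Plus then 1 else 0) * ?w \<xi>)"
    using fin root by (subst sum.inter_filter) (auto intro!: sum.cong)
  hence 1: "(\<Sum>\<xi>\<in>{\<xi> \<in> \<Lambda> \<rightarrow>\<^sub>E UNIV. \<xi> [] = Plus}. ?w \<xi>) * ?o = msg S \<eta> n [] Plus"
    using key[of "\<lambda>s. if s = Plus then 1 else 0"] by (simp add: sum_spin)
  have 2: "(\<Sum>\<xi>\<in>\<Lambda> \<rightarrow>\<^sub>E UNIV. ?w \<xi>) * ?o = msg S \<eta> n [] Plus + msg S \<eta> n [] Minus"
    using key[of "\<lambda>_. 1"] by (simp add: sum_spin)
  have "(\<Sum>\<xi>\<in>{\<xi> \<in> \<Lambda> \<rightarrow>\<^sub>E UNIV. \<xi> [] = Plus}. ?w \<xi>) / (\<Sum>\<xi>\<in>\<Lambda> \<rightarrow>\<^sub>E UNIV. ?w \<xi>) =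
      msg S \<eta> n [] Plus / (msg S \<eta> n [] Plus + msg S \<eta> n [] Minus)"
    unfolding 2[symmetric] unfolding 1[symmetric] using opos by simp
  thus ?thesis
    by (simp add: ising_spec_def sum_divide_distrib plus_of_log_msg)
qed

text \<open>Unnormalised law of the ball up to level \<open>m\<close>. Everything beyond that level
  enters through \<open>x v\<close>, the plus probability of \<open>v\<close> in its own subtree,
  cut off from its parent.\<close>

definition ball_prob :: "nat \<Rightarrow> (nat list \<Rightarrow> real) \<Rightarrow> (nat list \<Rightarrow> spin) \<Rightarrow> real" where
  "ball_prob m x \<zeta> = ising_weight E \<beta> lam (below d m) \<zeta> * (\<Prod>v\<in>level d m. spin_prob (x v) (\<zeta> v))"

lemma sum_ising_spec_ball:
  fixes \<eta> :: "nat list \<Rightarrow> spin"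
  assumes "m < n" and \<zeta>: "\<zeta> \<in> below d (Suc m) \<rightarrow>\<^sub>E UNIV"
  defines "x \<equiv> \<lambda>v. plus_of (log_msg {} \<eta> (n - m) v)"
  shows "(\<Sum>\<xi>\<in>{\<xi> \<in> below d n \<rightarrow>\<^sub>E UNIV. \<forall>v\<in>below d (Suc m). \<xi> v = \<zeta> v}. ising_spec E \<beta> lam (below d n) \<xi> \<eta>) =
     ball_prob m x \<zeta> / (\<Sum>\<tau>\<in>below d (Suc m) \<rightarrow>\<^sub>E UNIV. ball_prob m x \<tau>)"
proof -
  let ?\<Lambda> = "below d n" and ?B = "below d (Suc m)"
  let ?w = "\<lambda>\<xi>. ising_weight E \<beta> lam ?\<Lambda> (override_on \<eta> \<xi> ?\<Lambda>)"
  let ?o = "outer_weight E \<beta> lam ?\<Lambda> ?\<Lambda> \<eta>"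
  have sub: "?B \<subseteq> ?\<Lambda>" using \<open>m < n\<close> by (intro below_mono) simp
  have opos: "?o > 0" using outer_weight_pos beta_pos lam_pos by blast
  \<comment> \<open>\<open>N\<close> collects the total masses of the messages at level
    \<open>m\<close>; only their normalised forms survive in the quotient.\<close>
  define N where "N = (\<Prod>v\<in>level d m. msg {} \<eta> (n - m) v Plus + msg {} \<eta> (n - m) v Minus)"
  have N: "N > 0" unfolding N_def by (intro prod_pos) (simp add: msg_sum_pos)
  have msg: "msg {} \<eta> (n - m) v s = (msg {} \<eta> (n - m) v Plus + msg {} \<eta> (n - m) v Minus) * spin_prob (x v) s" for v s
  proof -
    have "msg {} \<eta> (n - m) v Plus + msg {} \<eta> (n - m) v Minus \<noteq> 0"
      using msg_sum_pos[of "{}" \<eta> "n - m" v] by linarith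
    thus ?thesis unfolding x_def plus_of_log_msg[symmetric]
      by (cases s) (simp_all add: spin_prob_def field_simps)
  qed
  have F: "ball_weight d \<beta> (site_weight {} \<eta>) m \<tau> * (\<Prod>v\<in>level d m. msg {} \<eta> (n - m) v (\<tau> v)) = N * ball_prob m x \<tau>" for \<tau>
    by (subst msg) (simp add: ball_weight_site_weight prod.distrib N_def ball_prob_def)
  have key: "(\<Sum>\<xi>\<in>?\<Lambda> \<rightarrow>\<^sub>E UNIV. \<phi> (override_on \<eta> \<xi> ?\<Lambda>) * ?w \<xi>) * ?o = N * (\<Sum>\<tau>\<in>?B \<rightarrow>\<^sub>E UNIV. \<phi> \<tau> * ball_prob m x \<tau>)"
    if "depends_on ?B \<phi>" for \<phi>
    using sum_finite_volume[where S = "{}" and \<eta> = \<eta> and n = n, OF _ that] \<open>m < n\<close>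
    by (simp add: F sum_distrib_left mult_ac)
  have finL: "finite (?\<Lambda> \<rightarrow>\<^sub>E (UNIV :: spin set))" and finB: "finite (?B \<rightarrow>\<^sub>E (UNIV :: spin set))"
    by (simp_all add: finite_PiE)
  let ?\<phi> = "\<lambda>\<tau>. if \<forall>v\<in>?B. \<tau> v = \<zeta> v then 1 else 0 :: real"
  have "(\<Sum>\<xi>\<in>{\<xi> \<in> ?\<Lambda> \<rightarrow>\<^sub>E UNIV. \<forall>v\<in>?B. \<xi> v = \<zeta> v}. ?w \<xi>) =
      (\<Sum>\<xi>\<in>?\<Lambda> \<rightarrow>\<^sub>E UNIV. ?\<phi> (override_on \<eta> \<xi> ?\<Lambda>) * ?w \<xi>)"
  proof (subst sum.inter_filter[OF finL], intro sum.cong refl)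
    fix \<xi>
    have "(\<forall>v\<in>?B. override_on \<eta> \<xi> ?\<Lambda> v = \<zeta> v) = (\<forall>v\<in>?B. \<xi> v = \<zeta> v)"
      using sub by (auto simp: override_on_def)
    thus "(if \<forall>v\<in>?B. \<xi> v = \<zeta> v then ?w \<xi> else 0) = ?\<phi> (override_on \<eta> \<xi> ?\<Lambda>) * ?w \<xi>" by simp
  qed
  hence "(\<Sum>\<xi>\<in>{\<xi> \<in> ?\<Lambda> \<rightarrow>\<^sub>E UNIV. \<forall>v\<in>?B. \<xi> v = \<zeta> v}. ?w \<xi>) * ?o = N * (\<Sum>\<tau>\<in>?B \<rightarrow>\<^sub>E UNIV. ?\<phi> \<tau> * ball_prob m x \<tau>)"
    using key[of ?\<phi>] by (simp add: depends_on_def)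
  also have "(\<Sum>\<tau>\<in>?B \<rightarrow>\<^sub>E UNIV. ?\<phi> \<tau> * ball_prob m x \<tau>) = (\<Sum>\<tau>\<in>?B \<rightarrow>\<^sub>E UNIV. if \<tau> = \<zeta> then ball_prob m x \<tau> else 0)"
    by (intro sum.cong refl) (use \<zeta> in \<open>auto intro: PiE_ext\<close>)
  also have "\<dots> = ball_prob m x \<zeta>" using finB \<zeta> by simp
  finally have 1: "(\<Sum>\<xi>\<in>{\<xi> \<in> ?\<Lambda> \<rightarrow>\<^sub>E UNIV. \<forall>v\<in>?B. \<xi> v = \<zeta> v}. ?w \<xi>) * ?o = N * ball_prob m x \<zeta>" .
  have 2: "(\<Sum>\<xi>\<in>?\<Lambda> \<rightarrow>\<^sub>E UNIV. ?w \<xi>) * ?o = N * (\<Sum>\<tau>\<in>?B \<rightarrow>\<^sub>E UNIV. ball_prob m x \<tau>)"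
    using key[of "\<lambda>_. 1"] by (simp add: depends_on_def)
  have "(\<Sum>\<xi>\<in>{\<xi> \<in> ?\<Lambda> \<rightarrow>\<^sub>E UNIV. \<forall>v\<in>?B. \<xi> v = \<zeta> v}. ?w \<xi>) / (\<Sum>\<xi>\<in>?\<Lambda> \<rightarrow>\<^sub>E UNIV. ?w \<xi>) =
     (N * ball_prob m x \<zeta>) / (N * (\<Sum>\<tau>\<in>?B \<rightarrow>\<^sub>E UNIV. ball_prob m x \<tau>))"
    unfolding 1[symmetric] 2[symmetric] using opos by simp
  thus ?thesis using N by (simp add: ising_spec_def sum_divide_distrib[symmetric])
qed

text \<open>In other words, \<open>relay\<close> is the logistic map
  \<open>w \<mapsto> 1 / (1 + exp w)\<close> followed by
  \<open>ln (ising_h \<beta> x)\<close>.\<close>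

lemma plus_of_relay: "plus_of (relay w) = 1 / (1 + exp w)"
proof -
  have pos: "1 + \<beta> * exp w > 0" "\<beta> + exp w > 0" "1 + exp w > 0" "1 - \<beta> > 0" "1 + \<beta> > 0"
    using beta_pos beta_less by (auto intro!: add_pos_pos)
  have "exp (relay w) - \<beta> = (1 - \<beta>) * (1 + \<beta>) / (\<beta> + exp w)"
    unfolding exp_relay using pos by (simp add: divide_simps) (simp add: algebra_simps)
  moreover have "1 + exp (relay w) = (1 + \<beta>) * (1 + exp w) / (\<beta> + exp w)"
    unfolding exp_relay using pos by (simp add: divide_simps) (simp add: algebra_simps)
  ultimately have "plus_of (relay w) =
      ((1 - \<beta>) * (1 + \<beta>) / (\<beta> + exp w)) / ((1 - \<beta>) * ((1 + \<beta>) * (1 + exp w) / (\<beta> + exp w)))"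
    unfolding plus_of_def by (simp only:)
  also have "\<dots> = 1 / (1 + exp w)" using pos by (simp add: divide_simps)
  finally show ?thesis .
qed

end

section \<open>Exponential decay from the contraction rate\<close>

locale ising_contraction = antiferro_ising +
  fixes us \<alpha> :: real
  assumes fixed_point: "relay (ln lam + d * us) = us"
    and alpha_pos: "0 < \<alpha>" and alpha_less: "\<alpha> < 1"
    and contraction: "\<And>u::real. \<bar>u\<bar> \<le> umax \<Longrightarrow>
      (real d)\<^sup>2 * gain u * gain (relay (ln lam + d * u)) \<le> \<alpha>\<^sup>2"
begin

definition D0 :: real where "D0 = umax * pi * sqrt (2 / gain 0)"

lemma D0_nonneg: "0 \<le> D0"
  using umax_pos gain_zero_pos by (simp add: D0_def)

text \<open>\<open>k\<close> counts the levels left before depth \<open>n\<close>. At depth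
  \<open>n\<close> the messages are arbitrary and only the diameter bound holds; above it a pinned
  vertex carries the same value in both configurations, and a free one gains a factor
  \<open>\<alpha>\<close>.\<close>

lemma close_log_msg:
  assumes "\<And>v. v \<in> S \<Longrightarrow> length v < n \<Longrightarrow> \<eta> v = \<eta>' v" "length w + k = n"
  shows "close (\<alpha> ^ k * D0) (log_msg S \<eta> k w) (log_msg S \<eta>' k w)"
  using assms(2)
proof (induction k arbitrary: w)
  case 0
  show ?case using close_base[OF abs_log_msg_le abs_log_msg_le] by (simp add: D0_def)
next
  case (Suc k)
  have nn: "0 \<le> \<alpha> ^ j * D0" for j using alpha_pos D0_nonneg by simp
  show ?case
  proof (cases "w \<in> S")
    case True
    hence "\<eta> w = \<eta>' w" using assms(1) Suc.prems by simp
    hence "log_msg S \<eta>' (Suc k) w = log_msg S \<eta> (Suc k) w" using True by (simp add: log_msg_Suc)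
    thus ?thesis using close_refl[OF nn[of "Suc k"] abs_log_msg_le] by simp
  next
    case False
    have "close (\<alpha> * (\<alpha> ^ k * D0)) (relay (ln lam + (\<Sum>i<d. log_msg S \<eta> k (i # w))))
        (relay (ln lam + (\<Sum>i<d. log_msg S \<eta>' k (i # w))))"
      using Suc alpha_pos nn contraction by (intro close_relay) auto
    thus ?thesis using False by (simp add: log_msg_Suc mult.assoc)
  qed
qed

lemma close_log_msg_fixed_point: "close (\<alpha> ^ k * D0) (log_msg {} \<eta> k w) us"
proof (induction k arbitrary: w)
  case 0
  show ?case using close_base[OF abs_log_msg_le] abs_relay_le[of "ln lam + d * us"]
    by (simp add: D0_def fixed_point)
next
  case (Suc k)
  have "close (\<alpha> * (\<alpha> ^ k * D0)) (relay (ln lam + (\<Sum>i<d. log_msg {} \<eta> k (i # w))))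
      (relay (ln lam + (\<Sum>i<d. us)))"
    using Suc alpha_pos D0_nonneg contraction by (intro close_relay) auto
  thus ?case using fixed_point by (simp add: log_msg_Suc mult.assoc)
qed

lemma log_msg_tendsto: "(\<lambda>k. log_msg {} \<eta> k w) \<longlonglongrightarrow> us"
proof (rule LIM_zero_cancel, rule Lim_null_comparison)
  show "\<forall>\<^sub>F k in sequentially. norm (log_msg {} \<eta> k w - us) \<le> \<alpha> ^ k * D0 * sqrt (gain 0)"
    using close_imp_abs_diff_le[OF close_log_msg_fixed_point] alpha_pos D0_nonneg
    by (intro always_eventually) simp
  have "(\<lambda>k. \<alpha> ^ k * (D0 * sqrt (gain 0))) \<longlonglongrightarrow> 0 * (D0 * sqrt (gain 0))"
    using alpha_pos alpha_less by (intro tendsto_intros LIMSEQ_power_zero) auto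
  thus "(\<lambda>k. \<alpha> ^ k * D0 * sqrt (gain 0)) \<longlonglongrightarrow> 0" by (simp add: mult.assoc)
qed

definition mixing_const :: real where
  "mixing_const = (1 + \<beta>) / (1 - \<beta>) * (D0 * sqrt (gain 0))"

lemma mixing_const_nonneg: "0 \<le> mixing_const"
  using D0_nonneg beta_pos beta_less gain_zero_pos by (simp add: mixing_const_def)

lemma root_marginal_close:
  assumes "\<And>v. v \<in> S \<Longrightarrow> length v < n \<Longrightarrow> \<eta> v = \<eta>' v"
  shows "\<bar>plus_of (log_msg S \<eta> n []) - plus_of (log_msg S \<eta>' n [])\<bar> \<le> mixing_const * \<alpha> ^ n"
proof -
  have "\<bar>log_msg S \<eta> n [] - log_msg S \<eta>' n []\<bar> \<le> \<alpha> ^ n * D0 * sqrt (gain 0)"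
    using alpha_pos D0_nonneg by (intro close_imp_abs_diff_le close_log_msg[of S n]) (auto simp: assms)
  hence "(1 + \<beta>) / (1 - \<beta>) * \<bar>log_msg S \<eta> n [] - log_msg S \<eta>' n []\<bar> \<le>
     (1 + \<beta>) / (1 - \<beta>) * (\<alpha> ^ n * D0 * sqrt (gain 0))"
    using beta_pos beta_less by (intro mult_left_mono) auto
  also have "\<dots> = mixing_const * \<alpha> ^ n" by (simp add: mixing_const_def)
  finally show ?thesis using plus_of_lipschitz order_trans by blast
qed

text \<open>The root probability averages finite-volume marginals over random boundary values, each
  of which is close to the reference uniformly. The reference \<open>\<eta>0\<close> has to match
  \<open>\<sigma>\<close> on \<open>S\<close> only above depth \<open>n\<close>, so one reference
  serves two conditionings that differ further away.\<close>

lemma plus_prob_close: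
  assumes G: "conditioned_gibbs_measure V E \<beta> lam S \<sigma> \<mu>" and "n > 0" "[] \<notin> S"
    and agree: "\<And>v. v \<in> S \<Longrightarrow> length v < n \<Longrightarrow> \<eta>0 v = \<sigma> v"
  shows "\<bar>plus_prob [] \<mu> - plus_of (log_msg S \<eta>0 n [])\<bar> \<le> mixing_const * \<alpha> ^ n"
proof -
  let ?\<Lambda> = "below d n - S" and ?c = "plus_of (log_msg S \<eta>0 n [])"
  interpret prob_space \<mu> using G by (simp add: conditioned_gibbs_measure_def)
  let ?X = "{\<xi> \<in> ?\<Lambda> \<rightarrow>\<^sub>E UNIV. \<xi> [] = Plus}"
  obtain g where g: "integrable \<mu> g" "(\<integral>\<eta>. g \<eta> \<partial>\<mu>) = measure \<mu> {\<eta> \<in> space \<mu>. restrict \<eta> ?\<Lambda> \<in> ?X}"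
    "AE \<eta> in \<mu>. g \<eta> = (\<Sum>\<xi>\<in>?X. ising_spec E \<beta> lam ?\<Lambda> \<xi> \<eta>)"
    by (rule gibbs_measureE_event[OF G, of ?\<Lambda> ?X]) (use below_subset in auto)
  have "[] \<in> ?\<Lambda>" using assms(2,3) by (auto simp: below_def tree_verts_def)
  hence "{\<eta> \<in> space \<mu>. restrict \<eta> ?\<Lambda> \<in> ?X} = {\<eta> \<in> space \<mu>. \<eta> [] = Plus}" by auto
  hence p: "(\<integral>\<eta>. g \<eta> \<partial>\<mu>) = plus_prob [] \<mu>" using g(2) by (simp add: plus_prob_def)
  have "AE \<eta> in \<mu>. \<forall>v\<in>S. \<eta> v = \<sigma> v" using G by (simp add: conditioned_gibbs_measure_def)
  with g(3) have bd: "AE \<eta> in \<mu>. norm (g \<eta> - ?c) \<le> mixing_const * \<alpha> ^ n"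
  proof eventually_elim
    case (elim \<eta>)
    thus ?case using root_marginal_close[of S n \<eta> \<eta>0] agree
      by (simp add: sum_ising_spec_root[OF assms(3,2)])
  qed
  have int: "integrable \<mu> (\<lambda>\<eta>. g \<eta> - ?c)" using g(1) by simp
  have "plus_prob [] \<mu> - ?c = (\<integral>\<eta>. g \<eta> - ?c \<partial>\<mu>)"
    using g(1) p by (simp add: prob_space)
  also have "norm \<dots> \<le> (\<integral>\<eta>. norm (g \<eta> - ?c) \<partial>\<mu>)" by (rule integral_norm_bound)
  also have "\<dots> \<le> (\<integral>\<eta>. mixing_const * \<alpha> ^ n \<partial>\<mu>)"
    using int bd by (intro integral_mono_AE) auto
  finally show ?thesis by (simp add: prob_space)
qed

theorem strong_spatial_mixing_tree: "strong_spatial_mixing V E tree_root \<beta> lam"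
  unfolding strong_spatial_mixing_def tree_root_def
\<comment> \<open>The summand 1 makes the constant positive and settles \<open>n = 0\<close>. The
  factor 2 comes from the triangle inequality through a common reference.\<close>
proof (rule exI[of _ "1 + 2 * mixing_const"], intro conjI exI[of _ "- ln \<alpha>"] allI impI)
  show "0 < 1 + 2 * mixing_const" using mixing_const_nonneg by simp
  show "0 < - ln \<alpha>" using alpha_pos alpha_less by simp
  fix S T \<sigma>1 \<sigma>2 \<mu>1 \<mu>2
  assume A: "S \<subseteq> V \<and> S \<noteq> {} \<and> T \<subseteq> S \<and> T \<noteq> {} \<and> (\<forall>v\<in>S - T. \<sigma>1 v = \<sigma>2 v) \<and>
    conditioned_gibbs_measure V E \<beta> lam S \<sigma>1 \<mu>1 \<and> conditioned_gibbs_measure V E \<beta> lam S \<sigma>2 \<mu>2"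
  define n where "n = graph_dist_set E [] T"
  have far: "n \<le> length t" if "t \<in> T" for t
  proof -
    have "n \<le> graph_dist E [] t"
      unfolding n_def graph_dist_set_def using that by (intro cINF_lower) auto
    also have "\<dots> \<le> length t" using that A by (intro graph_dist_root_le) auto
    finally show ?thesis .
  qed
  have agree: "\<sigma>1 v = \<sigma>2 v" if "v \<in> S" "length v < n" for v
    using that A far[of v] by (cases "v \<in> T") auto
  have ex: "exp (- (- ln \<alpha>) * real n) = \<alpha> ^ n"
    using alpha_pos exp_of_nat_mult[of n "ln \<alpha>"] by (simp add: mult.commute)
  have pr: "0 \<le> plus_prob [] \<mu>" "plus_prob [] \<mu> \<le> 1" if "prob_space \<mu>" for \<mu> :: "(nat list \<Rightarrow> spin) measure"
    using that prob_space.prob_le_1 by (auto simp: plus_prob_def)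
  have ps: "prob_space \<mu>1" "prob_space \<mu>2" using A by (auto simp: conditioned_gibbs_measure_def)
  have "\<bar>plus_prob [] \<mu>1 - plus_prob [] \<mu>2\<bar> \<le> (1 + 2 * mixing_const) * \<alpha> ^ n"
  proof (cases "n = 0")
    case True
    have "\<bar>plus_prob [] \<mu>1 - plus_prob [] \<mu>2\<bar> \<le> 1" using pr[OF ps(1)] pr[OF ps(2)] by linarith
    thus ?thesis using True mixing_const_nonneg by simp
  next
    case n: False
    show ?thesis
    proof (cases "[] \<in> S")
      \<comment> \<open>The root has depth \<open>0 < n\<close>, so both conditionings pin it to the
        same spin.\<close>
      case True
      have "plus_prob [] \<mu>1 = plus_prob [] \<mu>2"
        using A True n agree[of "[]"] plus_prob_pinned[of V E \<beta> lam S \<sigma>1 \<mu>1 "[]"]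
          plus_prob_pinned[of V E \<beta> lam S \<sigma>2 \<mu>2 "[]"] by simp
      thus ?thesis using mixing_const_nonneg alpha_pos by simp
    next
      case False
      have "\<bar>plus_prob [] \<mu>1 - plus_of (log_msg S \<sigma>1 n [])\<bar> \<le> mixing_const * \<alpha> ^ n"
        using A n False by (intro plus_prob_close[of S \<sigma>1]) auto
      moreover have "\<bar>plus_prob [] \<mu>2 - plus_of (log_msg S \<sigma>1 n [])\<bar> \<le> mixing_const * \<alpha> ^ n"
        using A n False agree by (intro plus_prob_close[of S \<sigma>2]) auto
      ultimately have "\<bar>plus_prob [] \<mu>1 - plus_prob [] \<mu>2\<bar> \<le> 2 * mixing_const * \<alpha> ^ n" by linarith
      also have "\<dots> \<le> (1 + 2 * mixing_const) * \<alpha> ^ n"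
        using alpha_pos by (intro mult_right_mono) auto
      finally show ?thesis .
    qed
  qed
  thus "\<bar>plus_prob [] \<mu>1 - plus_prob [] \<mu>2\<bar> \<le>
      (1 + 2 * mixing_const) * exp (- (- ln \<alpha>) * real (graph_dist_set E [] T))"
    unfolding n_def[symmetric] ex .
qed

section \<open>Cylinder probabilities of an unconditioned Gibbs measure\<close>

definition xs :: real where "xs = plus_of us"

lemma xs_eq: "xs = 1 / (1 + lam * exp us ^ d)"
proof -
  have "xs = 1 / (1 + exp (ln lam + d * us))"
    unfolding xs_def plus_of_relay[symmetric] fixed_point ..
  thus ?thesis using lam_pos by (simp add: exp_add exp_of_nat_mult)
qed

lemma xs_pos: "0 < xs" and xs_less_1: "xs < 1"
  using lam_pos by (simp_all add: xs_eq add_pos_pos)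

lemma spin_prob_xs_pos: "0 < spin_prob xs s"
  using xs_pos xs_less_1 by (simp add: spin_prob_def)

lemma ball_prob_pos: "0 < ball_prob m (\<lambda>_. xs) \<zeta>"
  unfolding ball_prob_def using beta_pos lam_pos
  by (intro mult_pos_pos ising_weight_pos prod_pos) (auto simp: spin_prob_xs_pos)

lemma ball_prob_sum_pos: "0 < (\<Sum>\<tau>\<in>below d (Suc m) \<rightarrow>\<^sub>E UNIV. ball_prob m (\<lambda>_. xs) \<tau>)"
  by (intro sum_pos) (auto simp: finite_PiE ball_prob_pos PiE_eq_empty_iff)

text \<open>The finite-volume probability \<open>Q k\<close> of the cylinder has the same
  expectation for every \<open>k\<close>, and it tends to \<open>?L\<close> for each boundary
  configuration because all messages tend to \<open>us\<close>. Dominated convergence identifies the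
  two.\<close>

lemma gibbs_measure_cylinder:
  assumes G: "gibbs_measure V E \<beta> lam \<mu>" and \<zeta>: "\<zeta> \<in> below d (Suc m) \<rightarrow>\<^sub>E UNIV"
  shows "measure \<mu> (cylinder V (below d (Suc m)) \<zeta>) =
    ball_prob m (\<lambda>_. xs) \<zeta> / (\<Sum>\<tau>\<in>below d (Suc m) \<rightarrow>\<^sub>E UNIV. ball_prob m (\<lambda>_. xs) \<tau>)"
    (is "_ = ?L")
proof -
  have G': "conditioned_gibbs_measure V E \<beta> lam {} (\<lambda>_. undefined) \<mu>"
    using G by (simp add: gibbs_measure_def)
  interpret prob_space \<mu> using G' by (simp add: conditioned_gibbs_measure_def)
  have sp: "space \<mu> = space (config_space V)"
    using G' by (intro sets_eq_imp_space_eq) (simp add: conditioned_gibbs_measure_def)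
  \<comment> \<open>With this offset the messages entering at level \<open>m\<close> have depth
    \<open>Suc k\<close>, and \<open>\<Lambda> k\<close> contains the whole ball of the
    cylinder.\<close>
  define \<Lambda> where "\<Lambda> k = below d (k + Suc m)" for k
  define X where "X k = {\<xi> \<in> \<Lambda> k \<rightarrow>\<^sub>E UNIV. \<forall>v\<in>below d (Suc m). \<xi> v = \<zeta> v}" for k
  define Q where "Q k \<eta> = (\<Sum>\<xi>\<in>X k. ising_spec E \<beta> lam (\<Lambda> k) \<xi> \<eta>)" for k \<eta>
  have sub: "below d (Suc m) \<subseteq> \<Lambda> k" for k unfolding \<Lambda>_def by (rule below_mono) simp
  have "\<exists>g. integrable \<mu> g \<and> (\<integral>\<eta>. g \<eta> \<partial>\<mu>) = measure \<mu> (cylinder V (below d (Suc m)) \<zeta>) \<and> (AE \<eta> in \<mu>. g \<eta> = Q k \<eta>)" for k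
  proof -
    have "{\<eta> \<in> space \<mu>. restrict \<eta> (\<Lambda> k) \<in> X k} = cylinder V (below d (Suc m)) \<zeta>"
      using sub[of k] by (auto simp: X_def cylinder_def sp)
    moreover obtain g where "integrable \<mu> g" "(\<integral>\<eta>. g \<eta> \<partial>\<mu>) = measure \<mu> {\<eta> \<in> space \<mu>. restrict \<eta> (\<Lambda> k) \<in> X k}"
      "AE \<eta> in \<mu>. g \<eta> = (\<Sum>\<xi>\<in>X k. ising_spec E \<beta> lam (\<Lambda> k) \<xi> \<eta>)"
      by (rule gibbs_measureE_event[OF G', of "\<Lambda> k" "X k"]) (use below_subset in \<open>auto simp: \<Lambda>_def X_def\<close>)
    ultimately show ?thesis by (auto simp: Q_def)
  qed
  then obtain g where g: "\<And>k. integrable \<mu> (g k)" "\<And>k. (\<integral>\<eta>. g k \<eta> \<partial>\<mu>) = measure \<mu> (cylinder V (below d (Suc m)) \<zeta>)"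
    "\<And>k. AE \<eta> in \<mu>. g k \<eta> = Q k \<eta>" by metis
  have lim: "(\<lambda>k. Q k \<eta>) \<longlonglongrightarrow> ?L" for \<eta>
  proof -
    have p: "(\<lambda>k. plus_of (log_msg {} \<eta> (Suc k) v)) \<longlonglongrightarrow> xs" for v
    proof -
      have "isCont plus_of us"
        unfolding plus_of_def [abs_def] using beta_less
        by (intro continuous_intros) (auto simp: add_pos_pos less_imp_neq[symmetric])
      from isCont_tendsto_compose[OF this LIMSEQ_Suc[OF log_msg_tendsto]]
      show ?thesis by (simp add: xs_def)
    qed
    have "(\<lambda>k. ball_prob m (\<lambda>v. plus_of (log_msg {} \<eta> (Suc k) v)) \<tau>) \<longlonglongrightarrow> ball_prob m (\<lambda>_. xs) \<tau>" for \<tau>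
    proof -
      have "(\<lambda>k. spin_prob (plus_of (log_msg {} \<eta> (Suc k) v)) s) \<longlonglongrightarrow> spin_prob xs s" for v s
        unfolding spin_prob_def using p[of v] by (cases s) (auto intro!: tendsto_intros)
      thus ?thesis unfolding ball_prob_def by (intro tendsto_intros)
    qed
    hence "(\<lambda>k. ball_prob m (\<lambda>v. plus_of (log_msg {} \<eta> (Suc k) v)) \<zeta> /
      (\<Sum>\<tau>\<in>below d (Suc m) \<rightarrow>\<^sub>E UNIV. ball_prob m (\<lambda>v. plus_of (log_msg {} \<eta> (Suc k) v)) \<tau>)) \<longlonglongrightarrow> ?L"
      using ball_prob_sum_pos[of m] by (intro tendsto_intros) auto
    moreover have "Q k \<eta> = ball_prob m (\<lambda>v. plus_of (log_msg {} \<eta> (Suc k) v)) \<zeta> /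
      (\<Sum>\<tau>\<in>below d (Suc m) \<rightarrow>\<^sub>E UNIV. ball_prob m (\<lambda>v. plus_of (log_msg {} \<eta> (Suc k) v)) \<tau>)" for k
      unfolding Q_def X_def \<Lambda>_def
      by (subst sum_ising_spec_ball[OF _ \<zeta>]) (simp_all add: Suc_diff_le)
    ultimately show ?thesis by simp
  qed
  have bd: "norm (Q k \<eta>) \<le> 1" for k \<eta>
  proof -
    let ?w = "\<lambda>\<xi>. ising_weight E \<beta> lam (\<Lambda> k) (override_on \<eta> \<xi> (\<Lambda> k))"
    have fin: "finite (\<Lambda> k \<rightarrow>\<^sub>E (UNIV :: spin set))" by (simp add: \<Lambda>_def finite_PiE)
    have w: "0 \<le> ?w \<xi>" for \<xi> using ising_weight_pos[OF beta_pos lam_pos] less_imp_le by blast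
    have "Q k \<eta> = sum ?w (X k) / sum ?w (\<Lambda> k \<rightarrow>\<^sub>E UNIV)"
      by (simp add: Q_def ising_spec_def sum_divide_distrib)
    moreover have "sum ?w (X k) \<le> sum ?w (\<Lambda> k \<rightarrow>\<^sub>E UNIV)"
      using fin w by (intro sum_mono2) (auto simp: X_def)
    moreover have "0 \<le> sum ?w (X k)" "0 \<le> sum ?w (\<Lambda> k \<rightarrow>\<^sub>E UNIV)" using w by (intro sum_nonneg; simp)+
    ultimately show ?thesis by (auto simp: divide_le_eq_1 order.order_iff_strict)
  qed
  have AEg: "AE \<eta> in \<mu>. \<forall>k. g k \<eta> = Q k \<eta>" using g(3) by (simp add: AE_all_countable)
  have "(\<lambda>k. \<integral>\<eta>. g k \<eta> \<partial>\<mu>) \<longlonglongrightarrow> (\<integral>\<eta>. ?L \<partial>\<mu>)"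
  proof (rule integral_dominated_convergence[where w = "\<lambda>_. 1"])
    show "AE \<eta> in \<mu>. (\<lambda>k. g k \<eta>) \<longlonglongrightarrow> ?L" using AEg by eventually_elim (simp add: lim)
    show "AE \<eta> in \<mu>. norm (g k \<eta>) \<le> 1" for k using g(3)[of k] by eventually_elim (use bd in simp)
  qed (use g(1) in auto)
  hence "(\<lambda>k::nat. measure \<mu> (cylinder V (below d (Suc m)) \<zeta>)) \<longlonglongrightarrow> ?L"
    by (simp add: g(2) prob_space)
  thus ?thesis by (simp add: LIMSEQ_const_iff)
qed

lemma gibbs_measure_unique:
  assumes "gibbs_measure V E \<beta> lam \<mu>" "gibbs_measure V E \<beta> lam \<nu>"
  shows "\<mu> = \<nu>"
proof (rule measure_eqI_cylinders)
  show "sets \<mu> = sets (config_space V)" "sets \<nu> = sets (config_space V)"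
    using assms by (auto simp: gibbs_measure_def conditioned_gibbs_measure_def)
  interpret M: prob_space \<mu> using assms by (simp add: gibbs_measure_def conditioned_gibbs_measure_def)
  interpret N: prob_space \<nu> using assms by (simp add: gibbs_measure_def conditioned_gibbs_measure_def)
  show "finite_measure \<mu>" by unfold_locales
  fix J assume "finite J" "J \<subseteq> V"
  then obtain m where "J \<subseteq> below d m" using finite_subset_below by blast
  hence J: "J \<subseteq> below d (Suc m)" by (auto simp: below_Suc)
  have "emeasure \<mu> (cylinder V (below d (Suc m)) \<kappa>) = emeasure \<nu> (cylinder V (below d (Suc m)) \<kappa>)" for \<kappa>
  proof -
    let ?\<zeta> = "restrict \<kappa> (below d (Suc m))"
    have "cylinder V (below d (Suc m)) \<kappa> = cylinder V (below d (Suc m)) ?\<zeta>" by (simp add: cylinder_def)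
    thus ?thesis
      using gibbs_measure_cylinder[OF assms(1), of ?\<zeta> m] gibbs_measure_cylinder[OF assms(2), of ?\<zeta> m]
      by (simp add: M.emeasure_eq_measure N.emeasure_eq_measure)
  qed
  thus "\<exists>K. finite K \<and> J \<subseteq> K \<and> K \<subseteq> V \<and> (\<forall>\<kappa>. emeasure \<mu> (cylinder V K \<kappa>) = emeasure \<nu> (cylinder V K \<kappa>))"
    using J below_subset by (intro exI[of _ "below d (Suc m)"]) auto
qed

end

section \<open>Existence\<close>

text \<open>The defining integrals over outside events are the values of two finite measures, with
  densities the indicator of the cylinder and \<open>g\<close>, pushed forward to the outside spins.
  These agree once they agree on cylinders over \<open>K\<close>; as \<open>K\<close> contains
  \<open>L\<close>, \<open>g\<close> is constant on each of them.\<close>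

lemma real_cond_exp_outside_eqI:
  fixes \<mu> :: "('v \<Rightarrow> spin) measure" and g :: "('v \<Rightarrow> spin) \<Rightarrow> real"
  assumes "prob_space \<mu>" and sets: "sets \<mu> = sets (config_space V)"
    and \<Lambda>: "finite \<Lambda>" "\<Lambda> \<subseteq> V"
    and L: "finite L" "L \<subseteq> V - \<Lambda>" "depends_on L g" and g01: "\<And>\<eta>. 0 \<le> g \<eta>" "\<And>\<eta>. g \<eta> \<le> 1"
    and cyl: "\<And>J. finite J \<Longrightarrow> J \<subseteq> V - \<Lambda> \<Longrightarrow> \<exists>K. finite K \<and> J \<union> L \<subseteq> K \<and> K \<subseteq> V - \<Lambda> \<and>
       (\<forall>\<kappa>. measure \<mu> (cylinder V \<Lambda> \<xi> \<inter> cylinder V K \<kappa>) = g \<kappa> * measure \<mu> (cylinder V K \<kappa>))"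
  shows "AE \<eta> in \<mu>. real_cond_exp \<mu> (outside_algebra V \<Lambda>) (indicator (cylinder V \<Lambda> \<xi>)) \<eta> = g \<eta>"
proof -
  interpret prob_space \<mu> by fact
  let ?F = "outside_algebra V \<Lambda>" and ?r = "\<lambda>\<eta>. restrict \<eta> (V - \<Lambda>)" and ?C = "cylinder V \<Lambda> \<xi>"
  interpret finite_measure_subalgebra \<mu> ?F
    by unfold_locales (rule subalgebra_outside[OF sets])
  have sp: "space \<mu> = space (config_space V)" using sets by (rule sets_eq_imp_space_eq)
  have r\<mu>: "?r \<in> measurable \<mu> (config_space (V - \<Lambda>))"
    using measurable_restrict_config[of "V - \<Lambda>" V] measurable_cong_sets[OF sets refl] by auto
  have rsp: "?r \<in> space (config_space V) \<rightarrow> space (config_space (V - \<Lambda>))"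
    by (auto simp: space_config_space)
  have C: "?C \<in> sets \<mu>" using cylinder_in_sets[OF \<Lambda>] sets by simp
  have gF: "g \<in> borel_measurable ?F"
  proof (rule measurable_depends_on[OF L(1,3)])
    have "(\<lambda>\<eta>. restrict (?r \<eta>) L) \<in> measurable ?F (config_space L)"
      unfolding outside_algebra_def
      by (rule measurable_compose[OF measurable_vimage_algebra1[OF rsp] measurable_restrict_config[OF L(2)]])
    moreover have "restrict (?r \<eta>) L = restrict \<eta> L" for \<eta> :: "'v \<Rightarrow> spin"
      using L(2) by (auto simp: fun_eq_iff restrict_def)
    ultimately show "(\<lambda>\<eta>. restrict \<eta> L) \<in> measurable ?F (config_space L)" by simp
  qed simp
  have g\<mu>: "g \<in> borel_measurable \<mu>" by (rule measurable_from_subalg[OF subalg gF])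
  define P Q where "P = distr (density \<mu> (\<lambda>\<eta>. indicator ?C \<eta>)) (config_space (V - \<Lambda>)) ?r"
    and "Q = distr (density \<mu> (\<lambda>\<eta>. ennreal (g \<eta>))) (config_space (V - \<Lambda>)) ?r"
  have P: "emeasure P A = emeasure \<mu> (?C \<inter> (?r -` A \<inter> space \<mu>))" if A: "A \<in> sets (config_space (V - \<Lambda>))" for A
  proof -
    have A': "?r -` A \<inter> space \<mu> \<in> sets \<mu>" using measurable_sets[OF r\<mu> A] .
    have "emeasure P A = (\<integral>\<^sup>+ \<eta>. indicator ?C \<eta> * indicator (?r -` A \<inter> space \<mu>) \<eta> \<partial>\<mu>)"
      unfolding P_def using A A' C r\<mu> by (subst emeasure_distr) (auto simp: emeasure_density)
    also have "\<dots> = (\<integral>\<^sup>+ \<eta>. indicator (?C \<inter> (?r -` A \<inter> space \<mu>)) \<eta> \<partial>\<mu>)"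
      by (simp add: indicator_inter_arith)
    finally show ?thesis using A' C by simp
  qed
  have Q: "emeasure Q A = (\<integral>\<^sup>+ \<eta>. ennreal (g \<eta>) * indicator (?r -` A \<inter> space \<mu>) \<eta> \<partial>\<mu>)"
    if A: "A \<in> sets (config_space (V - \<Lambda>))" for A
  proof -
    have A': "?r -` A \<inter> space \<mu> \<in> sets \<mu>" using measurable_sets[OF r\<mu> A] .
    show ?thesis
      unfolding Q_def using A A' g\<mu> r\<mu> by (subst emeasure_distr) (auto simp: emeasure_density)
  qed
  have "P = Q"
  proof (rule measure_eqI_cylinders)
    show "sets P = sets (config_space (V - \<Lambda>))" "sets Q = sets (config_space (V - \<Lambda>))"
      by (simp_all add: P_def Q_def)
    show "finite_measure P"
    proof
      have "space P = space (config_space (V - \<Lambda>))" by (simp add: P_def)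
      thus "emeasure P (space P) \<noteq> \<infinity>"
        using P[OF sets.top] by simp
    qed
    fix J assume J: "finite J" "J \<subseteq> V - \<Lambda>"
    from cyl[OF J] obtain K where K: "finite K" "J \<union> L \<subseteq> K" "K \<subseteq> V - \<Lambda>"
      "\<And>\<kappa>. measure \<mu> (?C \<inter> cylinder V K \<kappa>) = g \<kappa> * measure \<mu> (cylinder V K \<kappa>)"
      by (elim exE conjE) auto
    have "emeasure P (cylinder (V - \<Lambda>) K \<kappa>) = emeasure Q (cylinder (V - \<Lambda>) K \<kappa>)" for \<kappa>
    proof -
      have c: "cylinder (V - \<Lambda>) K \<kappa> \<in> sets (config_space (V - \<Lambda>))" using K by (intro cylinder_in_sets) auto
      have cV: "cylinder V K \<kappa> \<in> sets \<mu>" unfolding sets using K by (intro cylinder_in_sets) auto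
      have pre: "?r -` cylinder (V - \<Lambda>) K \<kappa> \<inter> space \<mu> = cylinder V K \<kappa>"
        using K(3) by (auto simp: cylinder_def sp space_config_space subset_iff)
      have "emeasure Q (cylinder (V - \<Lambda>) K \<kappa>) = (\<integral>\<^sup>+ \<eta>. ennreal (g \<eta>) * indicator (cylinder V K \<kappa>) \<eta> \<partial>\<mu>)"
        unfolding Q[OF c] pre ..
      also have "\<dots> = (\<integral>\<^sup>+ \<eta>. ennreal (g \<kappa>) * indicator (cylinder V K \<kappa>) \<eta> \<partial>\<mu>)"
      proof (intro nn_integral_cong)
        fix \<eta>
        show "ennreal (g \<eta>) * indicator (cylinder V K \<kappa>) \<eta> = ennreal (g \<kappa>) * indicator (cylinder V K \<kappa>) \<eta>"
        proof (cases "\<eta> \<in> cylinder V K \<kappa>")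
          case True
          hence "g \<eta> = g \<kappa>" using K(2) by (intro depends_onD[OF L(3)]) (auto simp: cylinder_def)
          thus ?thesis by simp
        qed simp
      qed
      also have "\<dots> = ennreal (g \<kappa> * measure \<mu> (cylinder V K \<kappa>))"
        using cV g01 by (simp add: nn_integral_cmult_indicator emeasure_eq_measure ennreal_mult)
      also have "\<dots> = emeasure P (cylinder (V - \<Lambda>) K \<kappa>)"
        unfolding P[OF c] pre by (simp add: emeasure_eq_measure K(4))
      finally show ?thesis by simp
    qed
    thus "\<exists>K. finite K \<and> J \<subseteq> K \<and> K \<subseteq> V - \<Lambda> \<and>
       (\<forall>\<kappa>. emeasure P (cylinder (V - \<Lambda>) K \<kappa>) = emeasure Q (cylinder (V - \<Lambda>) K \<kappa>))"
      using K by blast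
  qed
  show ?thesis
  proof (rule real_cond_exp_charact)
    fix A assume "A \<in> sets ?F"
    then obtain A' where A': "A' \<in> sets (config_space (V - \<Lambda>))" "A = ?r -` A' \<inter> space \<mu>"
      unfolding outside_algebra_def sets_vimage_algebra2[OF rsp] sp by blast
    have A: "A \<in> sets \<mu>" unfolding A'(2) using measurable_sets[OF r\<mu> A'(1)] .
    have "(\<integral>\<eta>\<in>A. indicator ?C \<eta> \<partial>\<mu>) = measure \<mu> (?C \<inter> A)"
    proof -
      have "(\<integral>\<eta>\<in>A. indicator ?C \<eta> \<partial>\<mu>) = (\<integral>\<eta>. (indicator (?C \<inter> A) \<eta> :: real) \<partial>\<mu>)"
        unfolding set_lebesgue_integral_def
        by (intro Bochner_Integration.integral_cong) (auto simp: indicator_def)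
      thus ?thesis using A C by simp
    qed
    also have "\<dots> = enn2real (emeasure P A')"
      using P[OF A'(1)] by (simp add: A'(2) measure_def)
    also have "\<dots> = enn2real (\<integral>\<^sup>+ \<eta>. ennreal (g \<eta>) * indicator A \<eta> \<partial>\<mu>)"
      unfolding \<open>P = Q\<close> Q[OF A'(1)] A'(2)[symmetric] ..
    also have "\<dots> = enn2real (\<integral>\<^sup>+ \<eta>. ennreal (indicator A \<eta> * g \<eta>) \<partial>\<mu>)"
      by (intro arg_cong[where f = enn2real] nn_integral_cong) (auto simp: indicator_def)
    also have "\<dots> = (\<integral>\<eta>. indicator A \<eta> * g \<eta> \<partial>\<mu>)"
      using A g\<mu> g01 by (intro integral_eq_nn_integral[symmetric]) auto
    finally show "(\<integral>\<eta>\<in>A. indicator ?C \<eta> \<partial>\<mu>) = (\<integral>\<eta>\<in>A. g \<eta> \<partial>\<mu>)"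
      by (simp add: set_lebesgue_integral_def)
  next
    show "integrable \<mu> (indicator ?C :: _ \<Rightarrow> real)"
      using C emeasure_finite by (intro integrable_real_indicator) (auto simp: less_top[symmetric])
    show "integrable \<mu> g"
      using g\<mu> g01 by (intro integrable_const_bound[where B = 1]) auto
  qed (rule gF)
qed

section \<open>Decoding independent responses\<close>

definition spin_pmf :: "real \<Rightarrow> spin pmf" where
  "spin_pmf p = map_pmf (\<lambda>b. if b then Plus else Minus) (bernoulli_pmf p)"

lemma pmf_spin_pmf:
  assumes "0 \<le> p" "p \<le> 1" shows "pmf (spin_pmf p) s = spin_prob p s"
proof -
  have inj: "inj (\<lambda>b. if b then Plus else Minus)" by (auto simp: inj_def)
  show ?thesis
    using pmf_map_inj'[OF inj, of "bernoulli_pmf p" True] pmf_map_inj'[OF inj, of "bernoulli_pmf p" False] assms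
    by (cases s) (simp_all add: spin_pmf_def spin_prob_def)
qed

definition pick :: "spin \<Rightarrow> spin \<times> spin \<Rightarrow> spin" where
  "pick s p = (if s = Plus then fst p else snd p)"

lemma measure_pick:
  "measure (measure_pmf (pair_pmf A B)) {p. pick s p = s'} = pmf (if s = Plus then A else B) s'"
  by (cases s) (simp_all add: pick_def map_fst_pair_pmf map_snd_pair_pmf vimage_def
      pmf_map[of fst "pair_pmf A B" s', symmetric, unfolded vimage_def, simplified]
      pmf_map[of snd "pair_pmf A B" s', symmetric, unfolded vimage_def, simplified])

text \<open>A random assignment \<open>U\<close> of response pairs to the vertices is decoded from the root downwards:
  the spin of a vertex is the response of that vertex to the spin of its parent.\<close>

primrec decode :: "(nat list \<Rightarrow> spin \<times> spin) \<Rightarrow> nat list \<Rightarrow> spin" where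
  "decode U [] = fst (U [])"
| "decode U (i # w) = pick (decode U w) (U (i # w))"

text \<open>The convention that the root has a plus parent makes it read \<open>fst\<close>, as
  \<open>decode\<close> does, so one formula covers all vertices.\<close>

definition parent_spin :: "(nat list \<Rightarrow> spin) \<Rightarrow> nat list \<Rightarrow> spin" where
  "parent_spin \<zeta> v = (if v = [] then Plus else \<zeta> (tl v))"

text \<open>Once the target \<open>\<zeta>\<close> is fixed, every parent spin is known, so the
  right-hand side constrains each coordinate of \<open>U\<close> separately and independence
  applies. The ball is closed under parents, which allows the induction from the root.\<close>

lemma decode_eq_iff:
  "(\<forall>v\<in>below d n. decode U v = \<zeta> v) \<longleftrightarrow> (\<forall>v\<in>below d n. pick (parent_spin \<zeta> v) (U v) = \<zeta> v)"
proof -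
  have dec: "decode U v = pick (parent_spin (decode U) v) (U v)" for v
    by (cases v) (auto simp: parent_spin_def pick_def)
  have tl: "i # w \<in> below d n \<Longrightarrow> w \<in> below d n" for i w
    by (auto simp: below_def tree_verts_def)
  have par: "parent_spin (decode U) v = parent_spin \<zeta> v" if "v \<in> below d n" "\<forall>v\<in>below d n. decode U v = \<zeta> v" for v
    using that tl by (cases v) (auto simp: parent_spin_def)
  have "decode U v = \<zeta> v" if *: "\<forall>v\<in>below d n. pick (parent_spin \<zeta> v) (U v) = \<zeta> v" and "v \<in> below d n" for v
    using that(2)
  proof (induction v)
    case Nil
    thus ?case using bspec[OF * Nil] by (simp add: parent_spin_def pick_def)
  next
    case (Cons i w)
    thus ?case using bspec[OF * Cons.prems] tl by (simp add: parent_spin_def)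
  qed
  thus ?thesis using dec par by metis
qed

section \<open>Locality and bounds of the specification\<close>

context antiferro_ising begin

lemma depends_on_ising_weight_override:
  assumes "\<Lambda> \<subseteq> below d n"
  shows "depends_on (below d (Suc n) - \<Lambda>) (\<lambda>\<eta>. ising_weight E \<beta> lam \<Lambda> (override_on \<eta> \<zeta> \<Lambda>))"
  unfolding depends_on_def
proof (intro allI impI)
  fix \<eta> \<eta>' :: "nat list \<Rightarrow> spin" assume eq: "\<forall>v\<in>below d (Suc n) - \<Lambda>. \<eta> v = \<eta>' v"
  let ?o = "override_on \<eta> \<zeta> \<Lambda>" and ?o' = "override_on \<eta>' \<zeta> \<Lambda>"
  have o: "?o v = ?o' v" if "v \<in> below d (Suc n)" for v
    using eq that by (auto simp: override_on_def)
  have "minus_count \<Lambda> ?o = minus_count \<Lambda> ?o'"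
    unfolding minus_count_def by (intro arg_cong[where f = card]) auto
  \<comment> \<open>The interaction has range one: an edge meeting the ball ends at most one level
    further down.\<close>
  moreover have "e \<subseteq> below d (Suc n)" if "e \<in> E" "e \<inter> \<Lambda> \<noteq> {}" for e
  proof -
    have "e \<in> {e \<in> E. e \<inter> below d n \<noteq> {}}" using that assms by blast
    thus ?thesis unfolding tree_edges_touching_below
      using below_mono[of n "Suc n" d] Cons_in_below by auto
  qed
  hence "?o u = ?o' u" if "e \<in> E" "e \<inter> \<Lambda> \<noteq> {}" "u \<in> e" for e u
    using that by (intro o) blast
  hence "(\<forall>u\<in>e. \<forall>v\<in>e. ?o u = ?o v) = (\<forall>u\<in>e. \<forall>v\<in>e. ?o' u = ?o' v)" if "e \<in> E" "e \<inter> \<Lambda> \<noteq> {}" for e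
    using that by simp
  hence "{e \<in> E. e \<inter> \<Lambda> \<noteq> {} \<and> (\<forall>u\<in>e. \<forall>v\<in>e. ?o u = ?o v)} = {e \<in> E. e \<inter> \<Lambda> \<noteq> {} \<and> (\<forall>u\<in>e. \<forall>v\<in>e. ?o' u = ?o' v)}"
    by blast
  ultimately show "ising_weight E \<beta> lam \<Lambda> ?o = ising_weight E \<beta> lam \<Lambda> ?o'"
    by (simp add: ising_weight_def equal_edge_count_def)
qed

lemma depends_on_ising_spec:
  assumes "\<Lambda> \<subseteq> below d n"
  shows "depends_on (below d (Suc n) - \<Lambda>) (ising_spec E \<beta> lam \<Lambda> \<xi>)"
  unfolding depends_on_def
proof (intro allI impI)
  fix \<eta> \<eta>' :: "nat list \<Rightarrow> spin" assume "\<forall>v\<in>below d (Suc n) - \<Lambda>. \<eta> v = \<eta>' v"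
  hence "ising_weight E \<beta> lam \<Lambda> (override_on \<eta> \<zeta> \<Lambda>) = ising_weight E \<beta> lam \<Lambda> (override_on \<eta>' \<zeta> \<Lambda>)" for \<zeta>
    using depends_on_ising_weight_override[OF assms, of \<zeta>] unfolding depends_on_def by blast
  thus "ising_spec E \<beta> lam \<Lambda> \<xi> \<eta> = ising_spec E \<beta> lam \<Lambda> \<xi> \<eta>'" unfolding ising_spec_def by simp
qed

lemma ising_spec_bounds:
  assumes "finite \<Lambda>" "\<xi> \<in> \<Lambda> \<rightarrow>\<^sub>E UNIV"
  shows "0 \<le> ising_spec E \<beta> lam \<Lambda> \<xi> \<eta>" "ising_spec E \<beta> lam \<Lambda> \<xi> \<eta> \<le> 1"
proof -
  let ?w = "\<lambda>\<xi>. ising_weight E \<beta> lam \<Lambda> (override_on \<eta> \<xi> \<Lambda>)"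
  have fin: "finite (\<Lambda> \<rightarrow>\<^sub>E (UNIV :: spin set))" using assms by (simp add: finite_PiE)
  have w: "0 < ?w \<zeta>" for \<zeta> using ising_weight_pos[OF beta_pos lam_pos] by blast
  have "?w \<xi> \<le> sum ?w (\<Lambda> \<rightarrow>\<^sub>E UNIV)"
    by (rule member_le_sum[OF assms(2) _ fin]) (rule less_imp_le[OF w])
  moreover from this have "0 < sum ?w (\<Lambda> \<rightarrow>\<^sub>E UNIV)" using w[of \<xi>] by linarith
  ultimately show "0 \<le> ising_spec E \<beta> lam \<Lambda> \<xi> \<eta>" "ising_spec E \<beta> lam \<Lambda> \<xi> \<eta> \<le> 1"
    unfolding ising_spec_def using w[of \<xi>] by (simp_all only: divide_le_eq_1_pos divide_nonneg_pos less_imp_le)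
qed

end

section \<open>The Markov chain built from the fixed point\<close>

context ising_contraction begin

definition norm_const :: "spin \<Rightarrow> real" where
  "norm_const s = (\<Sum>s'\<in>UNIV. (if s = s' then \<beta> else 1) * spin_prob xs s')"

lemma norm_const_pos: "0 < norm_const s"
  unfolding norm_const_def using beta_pos spin_prob_xs_pos
  by (intro sum_pos) auto

text \<open>The law of a child in its own subtree, tilted by the edge to a parent with spin
  \<open>s\<close>.\<close>

definition transition :: "spin \<Rightarrow> spin \<Rightarrow> real" where
  "transition s s' = (if s = s' then \<beta> else 1) * spin_prob xs s' / norm_const s"

lemma transition_pos: "0 < transition s s'"
  unfolding transition_def using beta_pos spin_prob_xs_pos norm_const_pos by (auto intro!: divide_pos_pos mult_pos_pos)

lemma transition_sum: "transition s Plus + transition s Minus = 1"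
proof -
  have "transition s Plus + transition s Minus = norm_const s / norm_const s"
    unfolding transition_def add_divide_distrib[symmetric] by (simp only: norm_const_def[of s] sum_spin)
  thus ?thesis using norm_const_pos[of s] by simp
qed

lemma spin_prob_transition: "spin_prob (transition s Plus) s' = transition s s'"
  using transition_sum[of s] by (cases s') (simp_all add: spin_prob_def)

text \<open>The two constants are the numerator and the denominator of \<open>ising_h\<close> at
  \<open>xs\<close>, and \<open>us\<close> is the logarithm of their quotient.\<close>

lemma norm_const_ratio: "norm_const Minus = exp us * norm_const Plus"
proof -
  define e where "e = exp us"
  have e: "e > 0" "1 + e > 0" "1 - \<beta> \<noteq> 0" using beta_less by (auto simp: e_def add_pos_pos)
  have xs: "(1 - \<beta>) * xs = (e - \<beta>) / (1 + e)"
    unfolding xs_def plus_of_def e_def[symmetric] using e by simp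
  have "norm_const Plus = 1 - (1 - \<beta>) * xs" "norm_const Minus = \<beta> + (1 - \<beta>) * xs"
    by (simp_all add: norm_const_def sum_spin spin_prob_def algebra_simps)
  hence "norm_const Plus = (1 + \<beta>) / (1 + e)" "norm_const Minus = e * (1 + \<beta>) / (1 + e)"
    unfolding xs using e by (simp_all add: field_simps)
  thus ?thesis by (simp add: e_def)
qed

text \<open>The fixed point equation for the law of a spin: attaching \<open>d\<close> subtrees
  whose roots have this law to a new vertex reproduces it up to a constant. The case of a plus spin
  determines \<open>?c\<close>.\<close>

lemma spin_prob_fixed_point: "\<exists>c>0. \<forall>s. spin_prob xs s = c * ((if s = Minus then lam else 1) * norm_const s ^ d)"
proof (intro exI conjI allI)
  let ?c = "xs / norm_const Plus ^ d"
  show "?c > 0" using xs_pos norm_const_pos by simp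
  have R: "1 + lam * exp us ^ d > 0" using lam_pos by (simp add: add_pos_pos)
  have "1 - xs = xs * (lam * exp us ^ d)" using R by (simp add: xs_eq field_simps)
  moreover have "norm_const Plus \<noteq> 0" using norm_const_pos[of Plus] by simp
  ultimately show "spin_prob xs s = ?c * ((if s = Minus then lam else 1) * norm_const s ^ d)" for s
    by (cases s) (simp_all add: spin_prob_def norm_const_ratio power_mult_distrib)
qed

definition site_pmf :: "nat list \<Rightarrow> (spin \<times> spin) pmf" where
  "site_pmf v = (if v = [] then pair_pmf (spin_pmf xs) (spin_pmf xs)
     else pair_pmf (spin_pmf (transition Plus Plus)) (spin_pmf (transition Minus Plus)))"

definition site_prob :: "(nat list \<Rightarrow> spin) \<Rightarrow> nat list \<Rightarrow> real" where
  "site_prob \<zeta> v = (if v = [] then spin_prob xs (\<zeta> v) else transition (\<zeta> (tl v)) (\<zeta> v))"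

lemma measure_site_pmf: "measure (measure_pmf (site_pmf v)) {p. pick (parent_spin \<zeta> v) p = \<zeta> v} = site_prob \<zeta> v"
proof (cases "v = []")
  case True
  thus ?thesis
    using xs_pos xs_less_1 by (simp add: site_pmf_def measure_pick site_prob_def pmf_spin_pmf)
next
  case False
  have "transition s Plus \<le> 1" for s
    using transition_sum[of s] transition_pos[of s Minus] by linarith
  thus ?thesis
    using False transition_pos[THEN less_imp_le]
    by (cases "\<zeta> (tl v)") (simp_all add: site_pmf_def measure_pick site_prob_def parent_spin_def pmf_spin_pmf spin_prob_transition)
qed

text \<open>As the image of a product measure the chain exists at once. The root starts from
  \<open>xs\<close> because it has \<open>d\<close> children like any other vertex.\<close>

definition tree_chain :: "(nat list \<Rightarrow> spin) measure" where
  "tree_chain = distr (PiM V (\<lambda>v. measure_pmf (site_pmf v))) (config_space V) (\<lambda>U. \<lambda>v\<in>V. decode U v)"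

lemma measurable_decode:
  "w \<in> V \<Longrightarrow> (\<lambda>U. decode U w) \<in> measurable (PiM V (\<lambda>v. measure_pmf (site_pmf v))) (count_space UNIV)"
proof (induction w)
  case Nil
  have [measurable]: "(\<lambda>U. U []) \<in> measurable (PiM V (\<lambda>v. measure_pmf (site_pmf v))) (count_space UNIV)"
    using measurable_component_singleton[OF Nil, of "\<lambda>v. measure_pmf (site_pmf v)"] by simp
  have "fst \<in> measurable (count_space (UNIV :: (spin \<times> spin) set)) (count_space UNIV)" by simp
  from measurable_compose[OF \<open>(\<lambda>U. U []) \<in> _\<close> this] show ?case by simp
next
  case (Cons i w)
  have w: "w \<in> V" using Cons.prems by (auto simp: tree_verts_def)
  have 1: "(\<lambda>U. U (i # w)) \<in> measurable (PiM V (\<lambda>v. measure_pmf (site_pmf v))) (count_space UNIV)"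
    using measurable_component_singleton[OF Cons.prems, of "\<lambda>v. measure_pmf (site_pmf v)"] by simp
  have "(\<lambda>U. pick s (U (i # w))) \<in> measurable (PiM V (\<lambda>v. measure_pmf (site_pmf v))) (count_space UNIV)" for s
    by (rule measurable_compose[OF 1]) simp
  from measurable_compose_countable'[OF this Cons.IH[OF w]] show ?case
    by (simp add: countable_finite)
qed

lemma measurable_decode_config:
  "(\<lambda>U. \<lambda>v\<in>V. decode U v) \<in> measurable (PiM V (\<lambda>v. measure_pmf (site_pmf v))) (config_space V)"
  unfolding config_space_def by (rule measurable_restrict) (rule measurable_decode)

lemma prob_space_tree_chain: "prob_space tree_chain"
  unfolding tree_chain_def
  by (rule prob_space.prob_space_distr[OF prob_space_PiM measurable_decode_config])
    (rule measure_pmf.prob_space_axioms)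

lemma sets_tree_chain: "sets tree_chain = sets (config_space V)"
  by (simp add: tree_chain_def)

lemma tree_chain_cylinder: "measure tree_chain (cylinder V (below d n) \<zeta>) = (\<Prod>v\<in>below d n. site_prob \<zeta> v)"
proof -
  let ?M = "PiM V (\<lambda>v. measure_pmf (site_pmf v))"
  interpret product_prob_space "\<lambda>v. measure_pmf (site_pmf v)" V by unfold_locales
  have c: "cylinder V (below d n) \<zeta> \<in> sets (config_space V)"
    by (intro cylinder_in_sets below_subset) simp
  have "measure tree_chain (cylinder V (below d n) \<zeta>) =
      measure ?M ((\<lambda>U. \<lambda>v\<in>V. decode U v) -` cylinder V (below d n) \<zeta> \<inter> space ?M)"
    unfolding tree_chain_def by (rule measure_distr[OF measurable_decode_config c])
  also have "(\<lambda>U. \<lambda>v\<in>V. decode U v) -` cylinder V (below d n) \<zeta> \<inter> space ?M =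
      {U \<in> space ?M. \<forall>v\<in>below d n. decode U v = \<zeta> v}"
    using below_subset[of d n] by (auto simp: cylinder_def space_config_space subset_iff)
  also have "\<dots> = {U \<in> space ?M. \<forall>v\<in>below d n. U v \<in> {p. pick (parent_spin \<zeta> v) p = \<zeta> v}}"
    unfolding decode_eq_iff by simp
  also have "measure ?M \<dots> = (\<Prod>v\<in>below d n. measure (measure_pmf (site_pmf v)) {p. pick (parent_spin \<zeta> v) p = \<zeta> v})"
    unfolding measure_def[of ?M] emeasure_PiM_Collect[OF below_subset finite_below, simplified]
    by (simp add: measure_pmf.emeasure_eq_measure prod_ennreal prod_nonneg)
  finally show ?thesis by (simp only: measure_site_pmf)
qed

text \<open>This ties the chain to the Gibbs weights: its marginal on a ball is the Ising weight
  with independent boundary factors. Passing to the next ball uses the fixed point equation once at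
  each vertex of the old boundary level.\<close>

lemma tree_chain_ball_prob:
  "\<exists>c>0. \<forall>\<zeta>. measure tree_chain (cylinder V (below d (Suc n)) \<zeta>) = c * ball_prob n (\<lambda>_. xs) \<zeta>"
  unfolding tree_chain_cylinder
proof (induction n)
  case 0
  show ?case
    by (intro exI[of _ 1])
      (simp add: below_Suc site_prob_def ball_prob_def ising_weight_def minus_count_def equal_edge_count_def)
next
  case (Suc n)
  obtain c where c: "c > 0" "\<And>\<zeta>. (\<Prod>v\<in>below d (Suc n). site_prob \<zeta> v) = c * ball_prob n (\<lambda>_. xs) \<zeta>"
    using Suc by blast
  obtain a where a: "a > 0" "\<And>s. spin_prob xs s = a * ((if s = Minus then lam else 1) * norm_const s ^ d)"
    using spin_prob_fixed_point by blast
  let ?l = "\<lambda>s. if s = Minus then lam else 1" and ?e = "\<lambda>s s'. if s = s' then \<beta> else 1"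
  \<comment> \<open>The \<open>d\<close> normalisers in the transitions out of \<open>w\<close>
    cancel the power of \<open>norm_const\<close> supplied by the fixed point equation.\<close>
  have loc: "spin_prob xs (\<zeta> w) * (\<Prod>i<d. transition (\<zeta> w) (\<zeta> (i # w))) =
     a * ((?l (\<zeta> w) * (\<Prod>i<d. ?e (\<zeta> w) (\<zeta> (i # w)))) * (\<Prod>i<d. spin_prob xs (\<zeta> (i # w))))" for \<zeta> w
    using norm_const_pos[of "\<zeta> w"]
    by (simp only: a(2)[of "\<zeta> w"] transition_def prod_dividef prod.distrib) (simp add: field_simps)
  have "(\<Prod>v\<in>below d (Suc (Suc n)). site_prob \<zeta> v) = c * a ^ card (level d n) * ball_prob (Suc n) (\<lambda>_. xs) \<zeta>" for \<zeta>
  proof -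
    let ?W = "ising_weight E \<beta> lam (below d n) \<zeta>"
    have lev: "(\<Prod>v\<in>level d (Suc n). site_prob \<zeta> v) = (\<Prod>w\<in>level d n. \<Prod>i<d. transition (\<zeta> w) (\<zeta> (i # w)))"
      by (simp add: prod_level_Suc site_prob_def)
    have "(\<Prod>v\<in>below d (Suc (Suc n)). site_prob \<zeta> v) =
        c * ball_prob n (\<lambda>_. xs) \<zeta> * (\<Prod>v\<in>level d (Suc n). site_prob \<zeta> v)"
      by (simp only: prod_below_Suc[of _ d "Suc n"] c(2))
    also have "\<dots> = c * ?W * (\<Prod>w\<in>level d n. spin_prob xs (\<zeta> w) * (\<Prod>i<d. transition (\<zeta> w) (\<zeta> (i # w))))"
      by (simp add: lev ball_prob_def prod.distrib mult_ac)
    also have "\<dots> = c * ?W * (a ^ card (level d n) * ((\<Prod>w\<in>level d n. ?l (\<zeta> w) * (\<Prod>i<d. ?e (\<zeta> w) (\<zeta> (i # w)))) *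
        (\<Prod>v\<in>level d (Suc n). spin_prob xs (\<zeta> v))))"
      unfolding loc by (simp only: prod.distrib prod_constant prod_level_Suc)
    also have "\<dots> = c * a ^ card (level d n) * ball_prob (Suc n) (\<lambda>_. xs) \<zeta>"
      by (simp only: ball_prob_def ising_weight_below ball_weight_Suc mult_ac)
    finally show ?thesis .
  qed
  moreover have "c * a ^ card (level d n) > 0" using a c by simp
  ultimately show ?case by blast
qed

text \<open>Since \<open>\<Lambda>\<close> avoids level \<open>n\<close>, changing the spins on
  \<open>\<Lambda>\<close> affects only the Ising weight of \<open>\<Lambda>\<close>. All other
  factors form the constant \<open>C\<close>, which cancels in the quotient.\<close>

lemma tree_chain_conditional:
  assumes \<Lambda>: "\<Lambda> \<subseteq> below d n" and \<xi>: "\<xi> \<in> \<Lambda> \<rightarrow>\<^sub>E UNIV"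
  shows "measure tree_chain (cylinder V \<Lambda> \<xi> \<inter> cylinder V (below d (Suc n) - \<Lambda>) \<kappa>) =
    ising_spec E \<beta> lam \<Lambda> \<xi> \<kappa> * measure tree_chain (cylinder V (below d (Suc n) - \<Lambda>) \<kappa>)"
proof -
  interpret prob_space tree_chain by (rule prob_space_tree_chain)
  let ?B = "below d (Suc n)"
  let ?w = "\<lambda>\<zeta>. ising_weight E \<beta> lam \<Lambda> (override_on \<kappa> \<zeta> \<Lambda>)"
  obtain c where c: "c > 0" "\<And>\<zeta>. measure tree_chain (cylinder V ?B \<zeta>) = c * ball_prob n (\<lambda>_. xs) \<zeta>"
    using tree_chain_ball_prob by blast
  have sub: "\<Lambda> \<subseteq> ?B" using \<Lambda> below_mono[of n "Suc n" d] by auto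
  have fin: "finite \<Lambda>" using \<Lambda> by (rule finite_subset) simp
  have "?B - \<Lambda> \<subseteq> V" using below_subset by blast
  define C where "C = c * outer_weight E \<beta> lam \<Lambda> (below d n) \<kappa> * (\<Prod>v\<in>level d n. spin_prob xs (\<kappa> v))"
  have m: "measure tree_chain (cylinder V ?B (override_on \<kappa> \<zeta> \<Lambda>)) = C * ?w \<zeta>" for \<zeta>
  proof -
    have "override_on \<kappa> \<zeta> \<Lambda> v = \<kappa> v" if "v \<in> level d n" for v
      using that \<Lambda> below_Int_level[of n n d] by (auto simp: override_on_def)
    hence "(\<Prod>v\<in>level d n. spin_prob xs (override_on \<kappa> \<zeta> \<Lambda> v)) = (\<Prod>v\<in>level d n. spin_prob xs (\<kappa> v))" by simp
    thus ?thesis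
      using ising_weight_superset[OF finite_below \<Lambda> finite_tree_edges_touching_below]
      by (simp add: c(2) ball_prob_def C_def outer_weight_override mult_ac)
  qed
  have split: "cylinder V ?B (override_on \<kappa> \<zeta> \<Lambda>) = cylinder V \<Lambda> \<zeta> \<inter> cylinder V (?B - \<Lambda>) \<kappa>" for \<zeta>
    using sub by (auto simp: cylinder_def override_on_def)
  have "cylinder V (?B - \<Lambda>) \<kappa> = (\<Union>\<zeta>\<in>\<Lambda> \<rightarrow>\<^sub>E UNIV. cylinder V ?B (override_on \<kappa> \<zeta> \<Lambda>))"
  proof (intro equalityI subsetI)
    fix \<tau> assume "\<tau> \<in> cylinder V (?B - \<Lambda>) \<kappa>"
    hence "\<tau> \<in> cylinder V ?B (override_on \<kappa> (restrict \<tau> \<Lambda>) \<Lambda>)"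
      by (auto simp: cylinder_def override_on_def)
    thus "\<tau> \<in> (\<Union>\<zeta>\<in>\<Lambda> \<rightarrow>\<^sub>E UNIV. cylinder V ?B (override_on \<kappa> \<zeta> \<Lambda>))"
      by (intro UN_I[of "restrict \<tau> \<Lambda>"]) auto
  qed (auto simp: split)
  moreover have "measure tree_chain (\<Union>\<zeta>\<in>\<Lambda> \<rightarrow>\<^sub>E UNIV. cylinder V ?B (override_on \<kappa> \<zeta> \<Lambda>)) =
      (\<Sum>\<zeta>\<in>\<Lambda> \<rightarrow>\<^sub>E UNIV. measure tree_chain (cylinder V ?B (override_on \<kappa> \<zeta> \<Lambda>)))"
  proof (rule finite_measure_finite_Union)
    show "finite (\<Lambda> \<rightarrow>\<^sub>E (UNIV :: spin set))" using fin by (simp add: finite_PiE)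
    show "(\<lambda>\<zeta>. cylinder V ?B (override_on \<kappa> \<zeta> \<Lambda>)) ` (\<Lambda> \<rightarrow>\<^sub>E UNIV) \<subseteq> events"
      unfolding sets_tree_chain by (intro image_subsetI cylinder_in_sets below_subset) simp
    show "disjoint_family_on (\<lambda>\<zeta>. cylinder V ?B (override_on \<kappa> \<zeta> \<Lambda>)) (\<Lambda> \<rightarrow>\<^sub>E UNIV)"
    proof (unfold disjoint_family_on_def, intro ballI impI)
      fix \<zeta> \<zeta>' :: "nat list \<Rightarrow> spin" assume "\<zeta> \<in> \<Lambda> \<rightarrow>\<^sub>E UNIV" "\<zeta>' \<in> \<Lambda> \<rightarrow>\<^sub>E UNIV" "\<zeta> \<noteq> \<zeta>'"
      then obtain v where "v \<in> \<Lambda>" "\<zeta> v \<noteq> \<zeta>' v" by (meson PiE_ext)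
      thus "cylinder V ?B (override_on \<kappa> \<zeta> \<Lambda>) \<inter> cylinder V ?B (override_on \<kappa> \<zeta>' \<Lambda>) = {}"
        by (auto simp: split) (auto simp: cylinder_def)
    qed
  qed
  ultimately have tot: "measure tree_chain (cylinder V (?B - \<Lambda>) \<kappa>) = C * (\<Sum>\<zeta>\<in>\<Lambda> \<rightarrow>\<^sub>E UNIV. ?w \<zeta>)"
    by (simp add: m sum_distrib_left)
  have "(\<Sum>\<zeta>\<in>\<Lambda> \<rightarrow>\<^sub>E UNIV. ?w \<zeta>) > 0"
    using fin ising_weight_pos[OF beta_pos lam_pos] by (intro sum_pos) (auto simp: finite_PiE PiE_eq_empty_iff)
  thus ?thesis
    unfolding tot split[symmetric] m ising_spec_def by simp
qed

lemma gibbs_measure_tree_chain: "gibbs_measure V E \<beta> lam tree_chain"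
  unfolding gibbs_measure_def conditioned_gibbs_measure_def
proof (intro conjI allI impI)
  show "prob_space tree_chain" by (rule prob_space_tree_chain)
  show sets: "sets tree_chain = sets (config_space V)" by (rule sets_tree_chain)
  show "AE \<eta> in tree_chain. \<forall>v\<in>{}. \<eta> v = undefined" by simp
  fix \<Lambda> and \<xi> :: "nat list \<Rightarrow> spin"
  assume A: "finite \<Lambda> \<and> \<Lambda> \<subseteq> V - {} \<and> \<xi> \<in> \<Lambda> \<rightarrow>\<^sub>E UNIV"
  then obtain m where m: "\<Lambda> \<subseteq> below d m" using finite_subset_below[of \<Lambda> d] by auto
  have "AE \<eta> in tree_chain. real_cond_exp tree_chain (outside_algebra V \<Lambda>) (indicator (cylinder V \<Lambda> \<xi>)) \<eta> =
      ising_spec E \<beta> lam \<Lambda> \<xi> \<eta>"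
  proof (rule real_cond_exp_outside_eqI[OF prob_space_tree_chain sets, where L = "below d (Suc m) - \<Lambda>"])
    show "finite (below d (Suc m) - \<Lambda>)" "below d (Suc m) - \<Lambda> \<subseteq> V - \<Lambda>" using below_subset by auto
    show "depends_on (below d (Suc m) - \<Lambda>) (ising_spec E \<beta> lam \<Lambda> \<xi>)" by (rule depends_on_ising_spec[OF m])
    show "0 \<le> ising_spec E \<beta> lam \<Lambda> \<xi> \<eta>" "ising_spec E \<beta> lam \<Lambda> \<xi> \<eta> \<le> 1" for \<eta>
      using ising_spec_bounds A by auto
    fix J assume J: "finite J" "J \<subseteq> V - \<Lambda>"
    then obtain k where k: "J \<subseteq> below d k" using finite_subset_below[of J d] by auto
    \<comment> \<open>Large enough for the ball to contain \<open>J\<close> as well as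
      \<open>\<Lambda>\<close> and its outer boundary.\<close>
    define n where "n = max m k"
    have n: "\<Lambda> \<subseteq> below d n" "J \<subseteq> below d (Suc n)" "below d (Suc m) \<subseteq> below d (Suc n)"
      using m k below_mono[of m n d] below_mono[OF le_SucI, of k n d] below_mono[of "Suc m" "Suc n" d]
      by (auto simp: n_def)
    show "\<exists>K. finite K \<and> J \<union> (below d (Suc m) - \<Lambda>) \<subseteq> K \<and> K \<subseteq> V - \<Lambda> \<and>
       (\<forall>\<kappa>. measure tree_chain (cylinder V \<Lambda> \<xi> \<inter> cylinder V K \<kappa>) =
          ising_spec E \<beta> lam \<Lambda> \<xi> \<kappa> * measure tree_chain (cylinder V K \<kappa>))"
      using n J A below_subset[of d "Suc n"] tree_chain_conditional[OF n(1)]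
      by (intro exI[of _ "below d (Suc n) - \<Lambda>"]) auto
  qed (use A in auto)
  moreover have "cylinder V \<Lambda> \<xi> = {\<tau> \<in> space tree_chain. \<forall>v\<in>\<Lambda>. \<tau> v = \<xi> v}"
    using sets_eq_imp_space_eq[OF sets] by (simp add: cylinder_def)
  ultimately show "AE \<eta> in tree_chain. real_cond_exp tree_chain (outside_algebra V \<Lambda>)
      (indicator {\<tau> \<in> space tree_chain. \<forall>v\<in>\<Lambda>. \<tau> v = \<xi> v}) \<eta> = ising_spec E \<beta> lam \<Lambda> \<xi> \<eta>" by simp
qed

end

theorem mainTheorem4:
  fixes d :: nat and \<beta> lam xstar :: real
  assumes "d \<ge> 2"
    and "0 < \<beta>" and "\<beta> < 1"
    and "lam > 0"
    and "xstar \<in> {0..1}" and "ising_f d \<beta> lam xstar = xstar"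
    and "deriv (ising_f d \<beta> lam) xstar > -1"
  shows "strong_spatial_mixing (tree_verts d) (tree_edges d) tree_root \<beta> lam \<and>
    (\<exists>!\<mu>. gibbs_measure (tree_verts d) (tree_edges d) \<beta> lam \<mu>)"
proof -
  interpret A: antiferro_ising d \<beta> lam
    using assms by unfold_locales auto
  define us where "us = ln (ising_h \<beta> xstar)"
  have fp: "A.relay (ln lam + d * us) = us"
    unfolding us_def by (rule A.relay_fixed_point[OF assms(5,6)])
  have "real d * A.gain us < 1"
    using assms(7) unfolding us_def A.deriv_ising_f_fixed_point[OF assms(5,6)] by simp
  then obtain \<alpha> where "0 < \<alpha>" "\<alpha> < 1" "\<And>u::real. \<bar>u\<bar> \<le> A.umax \<Longrightarrow>
      (real d)\<^sup>2 * A.gain u * A.gain (A.relay (ln lam + d * u)) \<le> \<alpha>\<^sup>2"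
    using A.two_step_gain_bounded[OF fp] by blast
  then interpret ising_contraction d \<beta> lam us \<alpha>
    using fp by unfold_locales auto
  show ?thesis
    using strong_spatial_mixing_tree gibbs_measure_tree_chain gibbs_measure_unique by blast
qed

end
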